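(* Let $A\in\mathbb{R}^{m\times n}$ and $b\in\mathbb{R}^m$ be such that $Ax=b$ is consistent. Let $f:\mathbb{R}^n\to\mathbb{R}$ be $\gamma$-strongly convex ($\gamma>0$) and strongly admissible, and let $\widehat{x}$ be the solution of $\min_x f(x)$ subject to $Ax=b$. Suppose that the probability spaces $\{(\Omega_k,\mathcal{F}_k,P_k)\}_{k\ge 0}$ of sampling matrices are such that $\mathbb{E}_{S\in\Omega_k}[SS^\top]$ is positive definite for every $k\ge 0$. Let $\zeta\in(0,2)$ and let $\{x^k\}_{k\ge0}$, $\{z^k\}_{k\ge0}$ be the sequences generated by the SDCD algorithm (described in the context). Then for every $k\ge 0$ $$\mathbb{E}_k\left[D_{f,z^{k+1}}(x^{k+1},\widehat{x})\right]\le\left(1-\frac{\gamma\zeta(2-\zeta)\nu\lambda_{\min}(H_k)}{2\lambda_{\max}^{(k)}}\right)D_{f,z^k}(x^k,\widehat{x}),$$ where $\nu$, $H_k$, $\lambda_{\max}^{(k)}$ are defined in the context. Furthermore, $$\mathbb{E}\left[\|x^k-\widehat{x}\|_2^2\right]\le\frac{2D_{f,z^0}(x^0,\widehat{x})}{\gamma}\prod_{i=0}^{k-1}\left(1-\frac{\gamma\zeta(2-\zeta)\nu\lambda_{\min}(H_i)}{2\lambda_{\max}^{(i)}}\right).$$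
   Context: **Convexity notions.** A convex $f:\mathbb{R}^n\to\mathbb{R}$ is $\gamma$-strongly convex if $f(y)\ge f(x)+\langle z,y-x\rangle+\frac{\gamma}{2}\|y-x\|_2^2$ for all $x,y\in\mathbb{R}^n$, $z\in\partial f(x)$. Its conjugate is $f^*(y)=\sup_x\{\langle y,x\rangle-f(x)\}$ (which is then differentiable with $\frac1\gamma$-Lipschitz gradient). For $z\in\partial f(x)$, the Bregman distance is $D_{f,z}(x,y)=f(y)-f(x)-\langle z,y-x\rangle$. A convex differentiable function $g$ on $\mathbb{R}^m$ with nonempty minimizer set $X_g$ is restricted strongly convex if there is $\mu>0$ such that for all $y$, $\langle\nabla g(\mathrm{Proj}_{X_g}(y))-\nabla g(y),\mathrm{Proj}_{X_g}(y)-y\rangle\ge\mu\|\mathrm{Proj}_{X_g}(y)-y\|_2^2$, where $\mathrm{Proj}_{X_g}$ is the orthogonal projection onto $X_g$. A strongly convex $f$ is strongly admissible if $g(y)=f^*(A^\top y)-\langle b,y\rangle$ is restricted strongly convex on $\mathbb{R}^m$ for all $A\in\mathbb{R}^{m\times n}$ and all $b\in\mathrm{Range}(A)$. **The constant $\nu$.** If $f$ is strongly admissible, it is known that there exists $\nu>0$ with $D_{f,z}(x,\widehat{x})\le\frac1\nu\|A(x-\widehat{x})\|_2^2$ for all $x\in\mathbb{R}^n$ and all $z\in\partial f(x)\cap\mathrm{Range}(A^\top)$. $\nu$ denotes such a constant. **SDCD algorithm.** Each $\Omega_k$ is a set of real matrices with $m$ rows. Start with $z^0\in\mathrm{Range}(A^\top)$,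 $x^0=\nabla f^*(z^0)$. For $k=0,1,2,\dots$: draw $S_k\in\Omega_k$ according to $P_k$, independently of $S_0,\dots,S_{k-1}$; set $$\alpha_k=(2-\zeta)L_{\mathrm{adap}}^{k,\gamma},\quad L_{\mathrm{adap}}^{k,\gamma}=\frac{\gamma\|S_k^\top(Ax^k-b)\|_2^2}{\|A^\top S_kS_k^\top(Ax^k-b)\|_2^2}\quad\text{if }S_k^\top(Ax^k-b)\ne0,$$ and $\alpha_k=0$ otherwise; set $z^{k+1}=z^k-\alpha_kA^\top S_kS_k^\top(Ax^k-b)$ and $x^{k+1}=\nabla f^*(z^{k+1})$. **Notation.** $\mathbb{E}_k[\cdot]=\mathbb{E}[\cdot\mid S_0,\dots,S_{k-1}]$. With the convention $\frac00=0$, $$H_k=\begin{cases}\mathbb{E}_{S\in\Omega_k}[SS^\top]&\text{if }\Omega_k\text{ is bounded},\\ \mathbb{E}_{S\in\Omega_k}\left[\frac{SS^\top}{\|S\|_2^2}\right]&\text{otherwise},\end{cases}\qquad \lambda_{\max}^{(k)}=\begin{cases}\sup_{S\in\Omega_k}\lambda_{\max}(A^\top SS^\top A)&\text{if }\Omega_k\text{ is bounded},\\ \sup_{S\in\Omega_k}\lambda_{\max}\left(\frac{A^\top SS^\top A}{\|S\|_2^2}\right)&\text{otherwise}.\end{cases}$$ $\|S\|_2$ is the spectral norm; $\lambda_{\min},\lambda_{\max}$ denote smallest and largest eigenvalues. *)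

theory Defs
  imports "HOL-Probability.Probability"
begin

section \<open>Convex analysis\<close>

definition subdiff :: "(real^'n \<Rightarrow> real) \<Rightarrow> real^'n \<Rightarrow> (real^'n) set" where
  "subdiff f x = {z. \<forall>y. f y \<ge> f x + z \<bullet> (y - x)}"

definition strongly_convex :: "real \<Rightarrow> (real^'n \<Rightarrow> real) \<Rightarrow> bool" where
  "strongly_convex \<gamma> f \<longleftrightarrow> convex_on UNIV f \<and>
     (\<forall>x y. \<forall>z\<in>subdiff f x. f y \<ge> f x + z \<bullet> (y - x) + \<gamma> / 2 * (norm (y - x))\<^sup>2)"

text \<open>The supremum is taken in the reals; it is a genuine (finite) supremum whenever \<open>f\<close> is
  strongly convex, the only case in which it is used.\<close>

definition conjugate :: "(real^'n \<Rightarrow> real) \<Rightarrow> real^'n \<Rightarrow> real" where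
  "conjugate f y = (SUP x. y \<bullet> x - f x)"

definition gradient :: "(real^'n \<Rightarrow> real) \<Rightarrow> real^'n \<Rightarrow> real^'n" where
  "gradient g y = (THE d. GDERIV g y :> d)"

definition bregman :: "(real^'n \<Rightarrow> real) \<Rightarrow> real^'n \<Rightarrow> real^'n \<Rightarrow> real^'n \<Rightarrow> real" where
  "bregman f z x y = f y - f x - z \<bullet> (y - x)"

definition minimizers :: "(real^'m \<Rightarrow> real) \<Rightarrow> (real^'m) set" where
  "minimizers g = {y. is_arg_min g (\<lambda>_. True) y}"

definition restricted_strongly_convex :: "(real^'m \<Rightarrow> real) \<Rightarrow> bool" where
  "restricted_strongly_convex g \<longleftrightarrow>
     convex_on UNIV g \<and> g differentiable_on UNIV \<and> minimizers g \<noteq> {} \<and>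
     (\<exists>\<mu>>0. \<forall>y. let p = closest_point (minimizers g) y in
        (gradient g p - gradient g y) \<bullet> (p - y) \<ge> \<mu> * (norm (p - y))\<^sup>2)"

text \<open>The type argument fixes the number of rows \<open>m = CARD('m)\<close> of the matrices quantified over.\<close>

definition strongly_admissible :: "'m::finite itself \<Rightarrow> (real^'n \<Rightarrow> real) \<Rightarrow> bool" where
  "strongly_admissible _ f \<longleftrightarrow>
     (\<exists>\<gamma>>0. strongly_convex \<gamma> f) \<and>
     (\<forall>(A :: real^'n^'m) b. b \<in> range ((*v) A) \<longrightarrow>
        restricted_strongly_convex (\<lambda>y. conjugate f (transpose A *v y) - b \<bullet> y))"

section \<open>Eigenvalues of square matrices\<close>

definition eigenvalues :: "real^'n^'n \<Rightarrow> real set" where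
  "eigenvalues M = {l. \<exists>v. v \<noteq> 0 \<and> M *v v = l *\<^sub>R v}"

text \<open>Only used for symmetric matrices, whose set of real eigenvalues is finite and nonempty.\<close>

definition lambda_max :: "real^'n^'n \<Rightarrow> real" where
  "lambda_max M = Max (eigenvalues M)"

definition lambda_min :: "real^'n^'n \<Rightarrow> real" where
  "lambda_min M = Min (eigenvalues M)"

definition positive_definite :: "real^'n^'n \<Rightarrow> bool" where
  "positive_definite M \<longleftrightarrow> transpose M = M \<and> (\<forall>v. v \<noteq> 0 \<longrightarrow> v \<bullet> (M *v v) > 0)"

section \<open>Sampling matrices\<close>

text \<open>The sampling matrices have \<open>m = CARD('m)\<close> rows and an arbitrary number \<open>q\<close> of columns,
  which may differ from matrix to matrix. Such a matrix is represented by the list of its columns,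
  and a vector in \<open>q\<close>-dimensional space by the list of its entries.\<close>

type_synonym 'm smat = "(real^'m) list"

definition smat_vec :: "'m::finite smat \<Rightarrow> real list \<Rightarrow> real^'m" where
  "smat_vec S u = (\<Sum>(c, t) \<leftarrow> zip S u. t *\<^sub>R c)"

definition smat_tvec :: "'m::finite smat \<Rightarrow> real^'m \<Rightarrow> real list" where
  "smat_tvec S y = map (\<lambda>c. c \<bullet> y) S"

definition list_norm :: "real list \<Rightarrow> real" where
  "list_norm u = sqrt (\<Sum>t\<leftarrow>u. t\<^sup>2)"

text \<open>The matrix \<open>S S\<^sup>T\<close>.\<close>

definition gram :: "'m::finite smat \<Rightarrow> real^'m^'m" where
  "gram S = (\<chi> i j. \<Sum>c\<leftarrow>S. c $ i * c $ j)"

lemma gram_mult_vec: "gram S *v y = smat_vec S (smat_tvec S y)"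
proof (induction S)
  case Nil
  show ?case
    by (simp add: gram_def smat_vec_def smat_tvec_def matrix_vector_mult_def vec_eq_iff)
next
  case (Cons c S)
  have "gram (c # S) *v y = (c \<bullet> y) *\<^sub>R c + gram S *v y"
    by (simp add: gram_def matrix_vector_mult_def vec_eq_iff inner_vec_def
        sum_distrib_left sum.distrib algebra_simps)
  then show ?case
    using Cons by (simp add: smat_vec_def smat_tvec_def)
qed

text \<open>Using the unit ball rather than the unit sphere also covers matrices without columns.\<close>

definition spectral_norm :: "'m::finite smat \<Rightarrow> real" where
  "spectral_norm S = (SUP u\<in>{u. length u = length S \<and> list_norm u \<le> 1}. norm (smat_vec S u))"

text \<open>The measure \<open>P\<close> carries the whole probability space of sampling matrices; its sample set is
  \<open>space P\<close>. The convention \<open>0/0 = 0\<close> is provided by \<open>inverse 0 = 0\<close>.\<close>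

definition bounded_smats :: "'m::finite smat set \<Rightarrow> bool" where
  "bounded_smats \<Omega> \<longleftrightarrow> (\<exists>B. \<forall>S\<in>\<Omega>. spectral_norm S \<le> B)"

definition sampling_H :: "'m::finite smat measure \<Rightarrow> real^'m^'m" where
  "sampling_H P =
     (if bounded_smats (space P) then (\<integral>S. gram S \<partial>P)
      else (\<integral>S. gram S /\<^sub>R (spectral_norm S)\<^sup>2 \<partial>P))"

definition sampling_lambda_max :: "real^'n^'m \<Rightarrow> 'm::finite smat measure \<Rightarrow> real" where
  "sampling_lambda_max A P =
     (if bounded_smats (space P)
      then (SUP S\<in>space P. lambda_max (transpose A ** gram S ** A))
      else (SUP S\<in>space P.
              lambda_max ((transpose A ** gram S ** A) /\<^sub>R (spectral_norm S)\<^sup>2)))"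

definition contraction_factor ::
  "real \<Rightarrow> real \<Rightarrow> real \<Rightarrow> real^'n^'m \<Rightarrow> 'm::finite smat measure \<Rightarrow> real" where
  "contraction_factor \<gamma> \<zeta> \<nu> A P =
     1 - \<gamma> * \<zeta> * (2 - \<zeta>) * \<nu> * lambda_min (sampling_H P) / (2 * sampling_lambda_max A P)"

section \<open>The SDCD algorithm\<close>

definition L_adap :: "real \<Rightarrow> real^'n^'m \<Rightarrow> 'm::finite smat \<Rightarrow> real^'m \<Rightarrow> real" where
  "L_adap \<gamma> A S r =
     \<gamma> * (list_norm (smat_tvec S r))\<^sup>2 / (norm (transpose A *v smat_vec S (smat_tvec S r)))\<^sup>2"

definition sdcd_step_size :: "real \<Rightarrow> real \<Rightarrow> real^'n^'m \<Rightarrow> 'm::finite smat \<Rightarrow> real^'m \<Rightarrow> real" where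
  "sdcd_step_size \<gamma> \<zeta> A S r =
     (if smat_tvec S r \<noteq> replicate (length S) 0 then (2 - \<zeta>) * L_adap \<gamma> A S r else 0)"

definition sdcd_update ::
  "real \<Rightarrow> real \<Rightarrow> real^'n^'m \<Rightarrow> real^'m \<Rightarrow> 'm::finite smat \<Rightarrow> real^'n \<Rightarrow> real^'n \<Rightarrow> real^'n" where
  "sdcd_update \<gamma> \<zeta> A b S x z =
     (let r = A *v x - b
      in z - sdcd_step_size \<gamma> \<zeta> A S r *\<^sub>R (transpose A *v smat_vec S (smat_tvec S r)))"

text \<open>The sigma-algebra generated by \<open>S\<^sub>0, \<dots>, S\<^sub>k\<^sub>-\<^sub>1\<close>, where \<open>S\<^sub>i\<close> takes values in \<open>P i\<close>.\<close>

definition history :: "'w measure \<Rightarrow> (nat \<Rightarrow> 'a measure) \<Rightarrow> (nat \<Rightarrow> 'w \<Rightarrow> 'a) \<Rightarrow> nat \<Rightarrow> 'w measure" where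
  "history M P S k =
     vimage_algebra (space M) (\<lambda>\<omega>. \<lambda>i\<in>{..<k}. S i \<omega>) (PiM {..<k} P)"

end

theory Submission
  imports Defs
begin

text \<open>Strong convexity makes \<open>f\<^sup>*\<close> differentiable with \<open>1/\<gamma>\<close>-Lipschitz gradient, and
  \<open>D\<^sub>z(x, x\<^sub>*) = f(x\<^sub>*) + f\<^sup>*(z) - \<langle>z, x\<^sub>*\<rangle>\<close> for \<open>x = \<nabla>f\<^sup>*(z)\<close>. The quadratic upper bound on \<open>f\<^sup>*\<close> therefore
  controls the change of the Bregman distance along the direction \<open>t = A\<^sup>T S S\<^sup>T r\<close> with \<open>r = A x - b\<close>;
  since \<open>\<langle>t, x - x\<^sub>*\<rangle> = \<parallel>S\<^sup>T r\<parallel>\<^sup>2\<close>, the adaptive step size decreases it by at least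
  \<open>\<gamma>\<zeta>(2-\<zeta>)/2\<close> times \<open>\<parallel>S\<^sup>T r\<parallel>\<^sup>4 / \<parallel>t\<parallel>\<^sup>2\<close>, which dominates the (weighted) \<open>\<parallel>S\<^sup>T r\<parallel>\<^sup>2 / \<lambda>\<^sub>m\<^sub>a\<^sub>x\<close>. By
  independence the conditional expectation of the weighted \<open>\<parallel>S\<^sup>T r\<parallel>\<^sup>2\<close> is \<open>\<langle>r, H r\<rangle> \<ge> \<lambda>\<^sub>m\<^sub>i\<^sub>n(H) \<parallel>r\<parallel>\<^sup>2\<close>,
  and \<open>\<parallel>r\<parallel>\<^sup>2 \<ge> \<nu> D\<^sub>z(x, x\<^sub>*)\<close>. The decrease holds pointwise, so every iterate has a bounded Bregman
  distance, which gives integrability.\<close>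

section \<open>Conjugates of strongly convex functions\<close>

text \<open>The strict epigraph \<open>E\<close> is convex and misses \<open>(x, f x)\<close>. A
  separating hyperplane with normal \<open>(g, c)\<close> cannot be vertical, since testing it at
  \<open>x - g\<close> would force \<open>g = 0\<close>; its slope then gives the
  subgradient.\<close>

lemma convex_subdiff_nonempty:
  fixes f :: "real^'n \<Rightarrow> real"
  assumes "convex_on UNIV f"
  shows "subdiff f x \<noteq> {}"
proof -
  define E where "E = {p :: (real^'n) \<times> real. f (fst p) < snd p}"
  have "convex E"
    unfolding convex_alt
  proof (intro ballI allI impI)
    fix p q and u :: real
    assume pq: "p \<in> E" "q \<in> E" and u: "0 \<le> u \<and> u \<le> 1"
    have "f ((1 - u) *\<^sub>R fst p + u *\<^sub>R fst q) \<le> (1 - u) * f (fst p) + u * f (fst q)"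
      using assms u by (intro convex_onD) auto
    also have "\<dots> < (1 - u) * snd p + u * snd q"
    proof (cases "u = 0")
      case True
      then show ?thesis using pq by (simp add: E_def)
    next
      case False
      then have "u * f (fst q) < u * snd q" using pq u by (simp add: E_def)
      moreover have "(1 - u) * f (fst p) \<le> (1 - u) * snd p"
        using pq u by (intro mult_left_mono) (auto simp: E_def)
      ultimately show ?thesis by simp
    qed
    finally show "(1 - u) *\<^sub>R p + u *\<^sub>R q \<in> E" by (simp add: E_def)
  qed
  moreover have "(x, f x + 1) \<in> E" and "E \<inter> {(x, f x)} = {}" by (auto simp: E_def)
  ultimately have "\<exists>a \<beta>. a \<noteq> 0 \<and> (\<forall>p\<in>{(x, f x)}. a \<bullet> p \<le> \<beta>) \<and> (\<forall>p\<in>E. \<beta> \<le> a \<bullet> p)"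
    by (intro separating_hyperplane_sets) (auto simp: Int_commute)
  then obtain a \<beta> where a: "a \<noteq> 0"
    and ge: "\<And>p. p \<in> E \<Longrightarrow> a \<bullet> p \<ge> \<beta>" and le: "a \<bullet> (x, f x) \<le> \<beta>"
    by blast
  obtain g c where ac: "a = (g, c)" by (cases a)
  have sep: "g \<bullet> x + c * f x \<le> g \<bullet> y + c * t" if "f y < t" for y t
    using ge[of "(y, t)"] le that by (simp add: E_def ac)
  have "c \<ge> 0" using sep[of x "f x + 1"] by (simp add: algebra_simps)
  moreover have "c \<noteq> 0"
  proof
    assume "c = 0"
    then have "0 \<le> g \<bullet> (y - x)" for y
      using sep[of y "f y + 1"] by (simp add: inner_diff_right)
    from this[of "x - g"] have "g \<bullet> g \<le> 0" by simp
    then have "g = 0" by (metis inner_eq_zero_iff inner_ge_zero order_antisym)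
    then show False using a ac \<open>c = 0\<close> by (simp add: zero_prod_def)
  qed
  ultimately have c: "c > 0" by simp
  have "f x + (- (1 / c) *\<^sub>R g) \<bullet> (y - x) \<le> f y" for y
  \<comment> \<open>Separation speaks only about points strictly above the graph, so the bound is
    shown for every \<open>t\<close> above \<open>f y\<close>.\<close>
  proof (rule dense_ge)
    fix t assume "f y < t"
    then have "(g \<bullet> x + c * f x - g \<bullet> y) / c \<le> t"
      using sep[of y t] c by (simp add: divide_simps mult.commute)
    then show "f x + (- (1 / c) *\<^sub>R g) \<bullet> (y - x) \<le> t"
      using c by (simp add: inner_diff_right diff_divide_distrib add_divide_distrib)
  qed
  then show ?thesis unfolding subdiff_def by blast
qed

lemma strongly_convexD:
  assumes "strongly_convex \<gamma> f" "z \<in> subdiff f x"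
  shows "f x + z \<bullet> (y - x) + \<gamma> / 2 * (norm (y - x))\<^sup>2 \<le> f y"
  using assms by (simp add: strongly_convex_def)

text \<open>The subgradient condition says that \<open>x\<close> minimizes \<open>f\<close> minus
  the linear form of \<open>z\<close>. Quadratic growth of this function confines the search for a
  minimizer to a compact ball.\<close>

lemma subdiff_surj:
  fixes f :: "real^'n \<Rightarrow> real"
  assumes "strongly_convex \<gamma> f" "\<gamma> > 0"
  shows "\<exists>x. z \<in> subdiff f x"
proof -
  have cvx: "convex_on UNIV f" using assms by (simp add: strongly_convex_def)
  obtain g where g: "g \<in> subdiff f 0" using convex_subdiff_nonempty[OF cvx] by blast
  define \<phi> where "\<phi> x = f x - z \<bullet> x" for x
  \<comment> \<open>Beyond this radius the quadratic term of strong convexity at 0 outweighs the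
    linear term with slope \<open>g - z\<close>.\<close>
  define R where "R = 2 * norm (g - z) / \<gamma>"
  have R: "R \<ge> 0" using assms by (simp add: R_def)
  have far: "\<phi> 0 \<le> \<phi> x" if "norm x \<ge> R" for x
  proof -
    have "norm (g - z) * norm x \<le> \<gamma> / 2 * norm x * norm x"
      using that assms by (intro mult_right_mono) (auto simp: R_def field_simps)
    moreover have "- (norm (g - z) * norm x) \<le> (g - z) \<bullet> x"
      using Cauchy_Schwarz_ineq2[of "g - z" x] by linarith
    ultimately show ?thesis
      using strongly_convexD[OF assms(1) g, of x]
      by (simp add: \<phi>_def power2_eq_square inner_diff_left algebra_simps)
  qed
  have "continuous_on UNIV f" using cvx by (intro convex_on_continuous) auto
  then have "continuous_on (cball 0 R) f" by (rule continuous_on_subset) simp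
  then have "continuous_on (cball 0 R) \<phi>" unfolding \<phi>_def by (intro continuous_intros)
  then have "\<exists>x\<in>cball 0 R. \<forall>y\<in>cball 0 R. \<phi> x \<le> \<phi> y"
    using R by (intro continuous_attains_inf) auto
  then obtain x where "\<forall>y\<in>cball 0 R. \<phi> x \<le> \<phi> y" by blast
  then have x: "\<phi> x \<le> \<phi> y" if "norm y \<le> R" for y using that by simp
  have "\<phi> x \<le> \<phi> y" for y
    using x[of y] x[of 0] far[of y] R by (cases "norm y \<le> R") auto
  then have "z \<in> subdiff f x"
    by (simp add: \<phi>_def subdiff_def inner_diff_right algebra_simps)
  then show ?thesis ..
qed

text \<open>Fenchel's equality: the supremum is attained at \<open>x\<close>, so it is a
  maximum.\<close>

lemma conjugate_eq:
  assumes "z \<in> subdiff f x"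
  shows "conjugate f z = z \<bullet> x - f x"
  unfolding conjugate_def
  using assms by (intro cSup_eq_maximum) (auto simp: subdiff_def inner_diff_right algebra_simps)

context
  fixes f :: "real^'n \<Rightarrow> real" and \<gamma> :: real
  assumes sc: "strongly_convex \<gamma> f" and \<gamma>: "\<gamma> > 0"
begin

text \<open>Sum of the strong convexity inequalities at \<open>x\<close> and at
  \<open>y\<close>.\<close>

lemma subdiff_strongly_monotone:
  assumes "z \<in> subdiff f x" "w \<in> subdiff f y"
  shows "\<gamma> * (norm (y - x))\<^sup>2 \<le> (w - z) \<bullet> (y - x)"
  using strongly_convexD[OF sc assms(1), of y] strongly_convexD[OF sc assms(2), of x]
  by (simp add: norm_minus_commute inner_diff_right inner_diff_left algebra_simps)

text \<open>Both bounds compare Fenchel's equality at \<open>z\<close> with the one at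
  \<open>w\<close>, attained at some \<open>y\<close>. The first uses the subgradient inequality at
  \<open>y\<close>; the second uses strong convexity at \<open>x\<close> and eliminates
  \<open>y - x\<close> by completing a square.\<close>

lemma conjugate_bounds:
  assumes "z \<in> subdiff f x"
  shows "conjugate f z + x \<bullet> (w - z) \<le> conjugate f w"
    and "conjugate f w \<le> conjugate f z + x \<bullet> (w - z) + (norm (w - z))\<^sup>2 / (2 * \<gamma>)"
proof -
  obtain y where y: "w \<in> subdiff f y" using subdiff_surj[OF sc \<gamma>] by blast
  show "conjugate f z + x \<bullet> (w - z) \<le> conjugate f w"
    using y[unfolded subdiff_def, simplified, rule_format, of x]
    unfolding conjugate_eq[OF assms] conjugate_eq[OF y]
    by (simp add: inner_diff_right inner_commute)
  have "(w - z) \<bullet> (y - x) - \<gamma> / 2 * (norm (y - x))\<^sup>2 \<le> (norm (w - z))\<^sup>2 / (2 * \<gamma>)"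
  proof -
    define p d where "p = w - z" and "d = y - x"
    have "0 \<le> (p - \<gamma> *\<^sub>R d) \<bullet> (p - \<gamma> *\<^sub>R d)" by simp
    also have "\<dots> = p \<bullet> p - 2 * \<gamma> * (p \<bullet> d) + \<gamma> * \<gamma> * (d \<bullet> d)"
      by (simp add: inner_diff_left inner_diff_right inner_commute[of d p] algebra_simps)
    finally have "p \<bullet> d - \<gamma> / 2 * (d \<bullet> d) \<le> p \<bullet> p / (2 * \<gamma>)" using \<gamma> by (simp add: field_simps)
    then show ?thesis by (simp add: p_def d_def power2_norm_eq_inner)
  qed
  then show "conjugate f w \<le> conjugate f z + x \<bullet> (w - z) + (norm (w - z))\<^sup>2 / (2 * \<gamma>)"
    using strongly_convexD[OF sc assms, of y]
    unfolding conjugate_eq[OF assms] conjugate_eq[OF y]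
    by (simp add: inner_diff_right inner_diff_left inner_commute algebra_simps)
qed

text \<open>The two bounds squeeze the first-order remainder between 0 and a multiple of the squared
  increment; uniqueness of derivatives then settles the definite description in
  \<open>gradient\<close>.\<close>

lemma gradient_conjugate:
  assumes "z \<in> subdiff f x"
  shows "GDERIV (conjugate f) z :> x" and "gradient (conjugate f) z = x"
proof -
  show *: "GDERIV (conjugate f) z :> x"
    unfolding gderiv_def has_derivative_at
  proof (intro conjI)
    show "bounded_linear (\<lambda>h. h \<bullet> x)" by (rule bounded_linear_inner_left)
    have "norm (norm (conjugate f (z + h) - conjugate f z - h \<bullet> x) / norm h) \<le> norm h / (2 * \<gamma>)" for h
    proof (cases "h = 0")
      case False
      have "norm (conjugate f (z + h) - conjugate f z - h \<bullet> x) \<le> norm h * (norm h / (2 * \<gamma>))"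
        using conjugate_bounds[OF assms, of "z + h"] by (simp add: inner_commute power2_eq_square)
      then show ?thesis using False \<gamma> by (simp add: pos_divide_le_eq mult.commute)
    qed (use \<gamma> in simp)
    moreover have "((\<lambda>h :: real^'n. norm h / (2 * \<gamma>)) \<longlongrightarrow> 0) (at 0)"
      using \<gamma> by (auto intro!: tendsto_eq_intros)
    ultimately show "(\<lambda>h. norm (conjugate f (z + h) - conjugate f z - h \<bullet> x) / norm h) \<midarrow>0\<rightarrow> 0"
      by (rule Lim_null_comparison[OF always_eventually[OF allI]])
  qed
  show "gradient (conjugate f) z = x"
    unfolding gradient_def
  proof (rule the_equality, rule *)
    fix d assume "GDERIV (conjugate f) z :> d"
    then have "(\<lambda>h. h \<bullet> d) = (\<lambda>h. h \<bullet> x)"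
      using * unfolding gderiv_def by (rule has_derivative_unique)
    then show "d = x" by (metis inner_commute vector_eq_rdot)
  qed
qed

lemma gradient_conjugate_subdiff: "z \<in> subdiff f (gradient (conjugate f) z)"
  using subdiff_surj[OF sc \<gamma>, of z] gradient_conjugate(2) by metis

lemma continuous_on_conjugate: "continuous_on UNIV (conjugate f)"
  using gradient_conjugate(1)[OF gradient_conjugate_subdiff]
  by (intro continuous_at_imp_continuous_on ballI has_derivative_continuous) (simp add: gderiv_def)

text \<open>Strong monotonicity with Cauchy-Schwarz makes the gradient Lipschitz. Its continuity is
  what makes the iterates measurable.\<close>

lemma continuous_on_gradient_conjugate: "continuous_on UNIV (gradient (conjugate f))"
proof (rule lipschitz_on_continuous_on)
  show "(1 / \<gamma>)-lipschitz_on UNIV (gradient (conjugate f))"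
  proof (rule lipschitz_onI)
    fix z w
    let ?d = "gradient (conjugate f) w - gradient (conjugate f) z"
    have "\<gamma> * (norm ?d)\<^sup>2 \<le> (w - z) \<bullet> ?d"
      by (rule subdiff_strongly_monotone[OF gradient_conjugate_subdiff gradient_conjugate_subdiff])
    also have "\<dots> \<le> norm (w - z) * norm ?d" by (rule norm_cauchy_schwarz)
    finally have "(\<gamma> * norm ?d) * norm ?d \<le> norm (w - z) * norm ?d"
      by (simp add: power2_eq_square mult.assoc)
    then have "\<gamma> * norm ?d \<le> norm (w - z)"
      by (cases "norm ?d = 0") auto
    then show "dist (gradient (conjugate f) z) (gradient (conjugate f) w) \<le> 1 / \<gamma> * dist z w"
      using \<gamma> by (simp add: dist_norm norm_minus_commute pos_le_divide_eq mult.commute)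
  qed (use \<gamma> in simp)
qed

text \<open>Fenchel's equality removes the value of \<open>f\<close> at the gradient. What remains
  depends on \<open>z\<close> through \<open>conjugate f\<close> and a linear term only, the form
  used for descent and measurability.\<close>

lemma bregman_conjugate:
  "bregman f z (gradient (conjugate f) z) y = f y + conjugate f z - z \<bullet> y"
  by (simp add: bregman_def inner_diff_right conjugate_eq[OF gradient_conjugate_subdiff])

lemma bregman_lower_bound:
  "\<gamma> / 2 * (norm (gradient (conjugate f) z - y))\<^sup>2 \<le> bregman f z (gradient (conjugate f) z) y"
  unfolding bregman_def norm_minus_commute[of _ y]
  using strongly_convexD[OF sc gradient_conjugate_subdiff[of z], of y] by linarith

end

section \<open>Extremal eigenvalues of symmetric matrices\<close>

lemma matrix_nth_inner: "G $ i $ j = axis i 1 \<bullet> (G *v axis j 1)" for G :: "real^'m^'n"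
  by (simp add: matrix_vector_mult_basis column_def inner_axis')

lemma transpose_vec_inner: "(transpose A *v y) \<bullet> x = y \<bullet> (A *v x)" for A :: "real^'n^'m"
  by (simp add: dot_lmul_matrix)

lemma symmetric_inner:
  fixes X :: "real^'n^'n"
  assumes "transpose X = X"
  shows "(X *v u) \<bullet> v = u \<bullet> (X *v v)"
  using transpose_vec_inner[of X u v] assms by simp

text \<open>Eigenvectors of distinct eigenvalues are orthogonal, hence independent. Finiteness is
  what gives \<open>Min\<close> and \<open>Max\<close> over the spectrum their meaning.\<close>

lemma finite_eigenvalues:
  fixes X :: "real^'n^'n"
  assumes "transpose X = X"
  shows "finite (eigenvalues X)"
proof -
  have "\<forall>l\<in>eigenvalues X. \<exists>v. v \<noteq> 0 \<and> X *v v = l *\<^sub>R v" by (simp add: eigenvalues_def)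
  then obtain v where v: "\<And>l. l \<in> eigenvalues X \<Longrightarrow> v l \<noteq> 0 \<and> X *v v l = l *\<^sub>R v l" by metis
  have orth: "v l \<bullet> v l' = 0" if "l \<in> eigenvalues X" "l' \<in> eigenvalues X" "l \<noteq> l'" for l l'
    using symmetric_inner[OF assms, of "v l" "v l'"] v that by simp
  then have "inj_on v (eigenvalues X)" using v by (metis inj_onI inner_eq_zero_iff)
  moreover have "finite (v ` eigenvalues X)"
    using orth v
    by (intro independent_imp_finite pairwise_orthogonal_independent)
      (auto simp: pairwise_def orthogonal_def)
  ultimately show ?thesis by (rule finite_imageD[rotated])
qed

text \<open>The quadratic form attains its minimum on the compact unit sphere, and the first-order
  condition there makes the minimizer an eigenvector. This also shows that the spectrum is
  nonempty.\<close>

lemma rayleigh_min: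
  fixes X :: "real^'n^'n"
  assumes "transpose X = X"
  obtains l where "l \<in> eigenvalues X" "\<And>v. l * (norm v)\<^sup>2 \<le> v \<bullet> (X *v v)"
proof -
  let ?q = "\<lambda>v. v \<bullet> (X *v v)"
  have "continuous_on (sphere 0 1) ?q"
    by (intro continuous_intros linear_continuous_on linear_conv_bounded_linear[THEN iffD1]) simp
  then obtain v0 where v0: "norm v0 = 1" and min: "\<And>v. norm v = 1 \<Longrightarrow> ?q v0 \<le> ?q v"
    using continuous_attains_inf[of "sphere 0 1" ?q] by auto
  define l where "l = ?q v0"
  have ge: "l * (norm v)\<^sup>2 \<le> ?q v" for v
  proof (cases "v = 0")
    case False
    then have "l \<le> ?q ((1 / norm v) *\<^sub>R v)" unfolding l_def by (intro min) simp
    then show ?thesis using False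
      by (simp add: matrix_vector_mult_scaleR divide_simps power2_eq_square mult.assoc)
  qed simp
  \<comment> \<open>Perturbing the minimizer \<open>v0\<close> in the direction of its residual \<open>w\<close> shows that \<open>w\<close> vanishes.\<close>
  define w where "w = X *v v0 - l *\<^sub>R v0"
  have lin: "2 * (w \<bullet> w) * t \<le> (?q w - l * (norm w)\<^sup>2) * t\<^sup>2" for t
  proof -
    have "l * (norm (v0 - t *\<^sub>R w))\<^sup>2 \<le> ?q (v0 - t *\<^sub>R w)" by (rule ge)
    also have "?q (v0 - t *\<^sub>R w) = ?q v0 - 2 * t * (w \<bullet> (X *v v0)) + t\<^sup>2 * ?q w"
      using symmetric_inner[OF assms, of w v0] inner_commute[of "X *v w" v0]
      by (simp add: matrix_vector_mult_diff_distrib matrix_vector_mult_scaleR power2_eq_square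
        inner_diff_left inner_diff_right algebra_simps)
    also have "(norm (v0 - t *\<^sub>R w))\<^sup>2 = 1 - 2 * t * (w \<bullet> v0) + t\<^sup>2 * (norm w)\<^sup>2"
      using v0 unfolding power2_norm_eq_inner
      by (simp add: inner_diff_left inner_diff_right algebra_simps inner_commute[of v0 w]
        power2_eq_square norm_eq_1)
    finally have "2 * t * (w \<bullet> (X *v v0) - l * (w \<bullet> v0)) \<le> (?q w - l * (norm w)\<^sup>2) * t\<^sup>2"
      by (simp add: l_def[symmetric] algebra_simps)
    moreover have "w \<bullet> w = w \<bullet> (X *v v0) - l * (w \<bullet> v0)"
      by (subst (2) w_def) (simp add: inner_diff_right)
    ultimately show ?thesis by (simp only: mult.assoc mult.commute mult.left_commute)
  qed
  have "w = 0"
  proof (rule ccontr)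
    assume "w \<noteq> 0"
    define c where "c = ?q w - l * (norm w)\<^sup>2"
    have p: "w \<bullet> w > 0" using \<open>w \<noteq> 0\<close> by simp
    have "c \<ge> 0" using ge[of w] by (simp add: c_def)
    \<comment> \<open>So small that the quadratic term in \<open>lin\<close> stays below the linear
      one; the summand 1 guards against \<open>c = 0\<close>.\<close>
    define t where "t = (w \<bullet> w) / (1 + c)"
    have t: "t > 0" "c * t < 2 * (w \<bullet> w)"
      using p mult_nonneg_nonneg[OF \<open>c \<ge> 0\<close>, of "w \<bullet> w"] \<open>c \<ge> 0\<close>
      by (auto simp: t_def field_simps add_nonneg_pos)
    then have "c * t * t < 2 * (w \<bullet> w) * t" by (intro mult_strict_right_mono)
    then show False using lin[of t] by (simp add: c_def power2_eq_square mult.assoc)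
  qed
  then have "l \<in> eigenvalues X" using v0 unfolding eigenvalues_def w_def
    by (intro CollectI exI[of _ v0]) auto
  then show thesis using ge that by blast
qed

lemma lambda_min_eigenvalue:
  assumes "transpose X = X"
  shows "lambda_min X \<in> eigenvalues X"
  unfolding lambda_min_def using rayleigh_min[OF assms] finite_eigenvalues[OF assms]
  by (metis Min_in empty_iff)

lemma lambda_min_le:
  assumes "transpose X = X"
  shows "lambda_min X * (norm v)\<^sup>2 \<le> v \<bullet> (X *v v)"
proof -
  obtain l where l: "l \<in> eigenvalues X" "l * (norm v)\<^sup>2 \<le> v \<bullet> (X *v v)"
    using rayleigh_min[OF assms] by metis
  have "lambda_min X \<le> l"
    unfolding lambda_min_def using finite_eigenvalues[OF assms] l(1) by (rule Min_le)
  then show ?thesis using l(2) by (meson mult_right_mono order_trans zero_le_power2)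
qed

lemma eigenvalues_uminus: "eigenvalues (- X) = uminus ` eigenvalues X"
proof -
  have "(- X) *v v = l *\<^sub>R v \<longleftrightarrow> X *v v = (- l) *\<^sub>R v" for v l
    using matrix_vector_mult_diff_rdistrib[of 0 X v] by (metis diff_0 matrix_vector_mult_0 minus_equation_iff scaleR_minus_left)
  then have "l \<in> eigenvalues (- X) \<longleftrightarrow> - l \<in> eigenvalues X" for l
    by (simp add: eigenvalues_def)
  then show ?thesis by (force simp: image_iff)
qed

text \<open>Negating the matrix reduces every statement about the largest eigenvalue to one about
  the smallest.\<close>

lemma lambda_max_eq_lambda_min:
  assumes "transpose X = X"
  shows "lambda_max X = - lambda_min (- X)" and "transpose (- X) = - X"
proof -
  have "eigenvalues X \<noteq> {}" using lambda_min_eigenvalue[OF assms] by auto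
  then show "lambda_max X = - lambda_min (- X)"
    unfolding lambda_max_def lambda_min_def eigenvalues_uminus
    using finite_eigenvalues[OF assms] by (subst minus_Min_eq_Max) (simp_all add: image_image)
  show "transpose (- X) = - X" using assms by (simp add: transpose_def vec_eq_iff)
qed

lemma lambda_max_eigenvalue:
  assumes "transpose X = X"
  shows "lambda_max X \<in> eigenvalues X"
  using lambda_min_eigenvalue[OF lambda_max_eq_lambda_min(2)[OF assms]]
  by (auto simp: lambda_max_eq_lambda_min(1)[OF assms] eigenvalues_uminus)

lemma le_lambda_max:
  assumes "transpose X = X"
  shows "v \<bullet> (X *v v) \<le> lambda_max X * (norm v)\<^sup>2"
  using lambda_min_le[OF lambda_max_eq_lambda_min(2)[OF assms], of v]
    matrix_vector_mult_diff_rdistrib[of 0 X v]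
  by (simp add: lambda_max_eq_lambda_min(1)[OF assms])

section \<open>Sampling matrices\<close>

lemma inner_smat_vec_eq_sum:
  "length u = length S \<Longrightarrow> smat_vec S u \<bullet> y = (\<Sum>i<length S. u ! i * smat_tvec S y ! i)"
  by (simp add: smat_vec_def sum_list_sum_nth atLeast0LessThan inner_sum_left smat_tvec_def)

lemma list_norm_L2_set: "list_norm u = L2_set ((!) u) {..<length u}"
  by (simp add: list_norm_def L2_set_def sum_list_sum_nth atLeast0LessThan)

lemma length_smat_tvec [simp]: "length (smat_tvec S y) = length S"
  by (simp add: smat_tvec_def)

text \<open>Cauchy-Schwarz in the column coordinates, after \<open>S\<close> has been moved to the
  other side as its transpose.\<close>

lemma smat_vec_inner_le:
  assumes "length u = length S"
  shows "smat_vec S u \<bullet> y \<le> list_norm u * list_norm (smat_tvec S y)"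
proof -
  have "smat_vec S u \<bullet> y \<le> (\<Sum>i<length S. \<bar>u ! i\<bar> * \<bar>smat_tvec S y ! i\<bar>)"
    unfolding inner_smat_vec_eq_sum[OF assms] by (intro sum_mono) (metis abs_ge_self abs_mult)
  also have "\<dots> \<le> list_norm u * list_norm (smat_tvec S y)"
    using L2_set_mult_ineq[of "(!) u" "(!) (smat_tvec S y)" "{..<length S}"] assms
    by (simp add: list_norm_L2_set)
  finally show ?thesis .
qed

lemma inner_gram_eq_sum: "y \<bullet> (gram S *v y) = (\<Sum>i<length S. (smat_tvec S y ! i)\<^sup>2)"
  unfolding gram_mult_vec inner_commute[of y]
  by (simp add: inner_smat_vec_eq_sum power2_eq_square)

lemma inner_gram: "y \<bullet> (gram S *v y) = (list_norm (smat_tvec S y))\<^sup>2"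
  unfolding inner_gram_eq_sum
  by (simp add: list_norm_def sum_list_sum_nth atLeast0LessThan sum_nonneg)

lemma inner_gram_nonneg: "0 \<le> y \<bullet> (gram S *v y)"
  by (simp add: inner_gram)

lemma transpose_gram: "transpose (gram S) = gram S"
  by (simp add: gram_def transpose_def vec_eq_iff mult.commute)

lemma smat_tvec_eq_zero_iff: "smat_tvec S y = replicate (length S) 0 \<longleftrightarrow> y \<bullet> (gram S *v y) = 0"
proof -
  have "(\<Sum>i<length S. (smat_tvec S y ! i)\<^sup>2) = 0 \<longleftrightarrow> (\<forall>i<length S. smat_tvec S y ! i = 0)"
    by (subst sum_nonneg_eq_0_iff) auto
  then show ?thesis by (auto simp: inner_gram_eq_sum list_eq_iff_nth_eq)
qed

lemma list_norm_zeros: "list_norm (replicate n 0) = 0"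
  by (simp add: list_norm_def sum_list_replicate)

lemma list_norm_nonneg: "0 \<le> list_norm u"
  by (simp add: list_norm_L2_set L2_set_nonneg)

text \<open>Duality: a bound on the transpose applied to \<open>smat_vec S u\<close> itself,
  combined with Cauchy-Schwarz, leaves a common factor \<open>norm (smat_vec S u)\<close> to
  cancel.\<close>

lemma norm_smat_vec_le:
  assumes "length u = length S" "\<tau> \<ge> 0" "\<And>y. y \<bullet> (gram S *v y) \<le> \<tau>\<^sup>2 * (norm y)\<^sup>2"
  shows "norm (smat_vec S u) \<le> \<tau> * list_norm u"
proof -
  let ?v = "smat_vec S u"
  have "(list_norm (smat_tvec S ?v))\<^sup>2 \<le> (\<tau> * norm ?v)\<^sup>2"
    using assms(3)[of ?v] by (simp only: inner_gram power_mult_distrib)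
  then have le: "list_norm (smat_tvec S ?v) \<le> \<tau> * norm ?v"
    by (rule power2_le_imp_le) (use assms(2) in simp)
  have "norm ?v * norm ?v = ?v \<bullet> ?v" by (metis power2_norm_eq_inner power2_eq_square)
  also have "\<dots> \<le> list_norm u * list_norm (smat_tvec S ?v)" by (rule smat_vec_inner_le[OF assms(1)])
  also have "\<dots> \<le> list_norm u * (\<tau> * norm ?v)" by (intro mult_left_mono le list_norm_nonneg)
  finally have "norm ?v * norm ?v \<le> (\<tau> * list_norm u) * norm ?v" by (simp add: algebra_simps)
  then show ?thesis
    using mult_nonneg_nonneg[OF assms(2) list_norm_nonneg[of u]] by (cases "?v = 0") auto
qed

lemma inner_gram_le_sum: "y \<bullet> (gram S *v y) \<le> (\<Sum>c\<leftarrow>S. (norm c)\<^sup>2) * (norm y)\<^sup>2"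
proof -
  have "y \<bullet> (gram S *v y) = (\<Sum>c\<leftarrow>S. (c \<bullet> y)\<^sup>2)"
    unfolding inner_gram list_norm_def smat_tvec_def
    by (subst real_sqrt_pow2) (auto simp: comp_def intro!: sum_list_nonneg)
  also have "\<dots> \<le> (\<Sum>c\<leftarrow>S. (norm c)\<^sup>2 * (norm y)\<^sup>2)"
    by (intro sum_list_mono) (metis Cauchy_Schwarz_ineq power2_norm_eq_inner)
  finally show ?thesis by (simp add: sum_list_mult_const)
qed

text \<open>The Frobenius norm is a bound. Boundedness is needed before the real supremum in
  \<open>spectral_norm\<close> can be used as an upper bound.\<close>

lemma bdd_above_spectral_norm:
  "bdd_above ((\<lambda>u. norm (smat_vec S u)) ` {u. length u = length S \<and> list_norm u \<le> 1})"
proof (rule bdd_aboveI2)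
  fix u assume u: "u \<in> {u. length u = length S \<and> list_norm u \<le> 1}"
  let ?\<tau> = "sqrt (\<Sum>c\<leftarrow>S. (norm c)\<^sup>2)"
  have \<tau>: "0 \<le> (\<Sum>c\<leftarrow>S. (norm c)\<^sup>2)" by (intro sum_list_nonneg) auto
  have "norm (smat_vec S u) \<le> ?\<tau> * list_norm u"
    using u \<tau> inner_gram_le_sum[of _ S] by (intro norm_smat_vec_le) auto
  also have "\<dots> \<le> ?\<tau> * 1" using u \<tau> by (intro mult_left_mono) auto
  finally show "norm (smat_vec S u) \<le> ?\<tau>" by simp
qed

text \<open>Rescaling \<open>u\<close> to norm one puts it into the unit ball; if
  \<open>list_norm u = 0\<close>, Cauchy-Schwarz already gives a zero image.\<close>

lemma norm_smat_vec_le_spectral_norm: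
  assumes "length u = length S"
  shows "norm (smat_vec S u) \<le> spectral_norm S * list_norm u"
proof (cases "list_norm u = 0")
  case True
  have "smat_vec S u \<bullet> smat_vec S u \<le> 0"
    using smat_vec_inner_le[OF assms, of "smat_vec S u"] True by simp
  then have "smat_vec S u = 0" by (metis inner_eq_zero_iff inner_ge_zero order_antisym)
  then show ?thesis using True by simp
next
  case False
  define a where "a = 1 / list_norm u"
  have a: "a > 0" using False list_norm_nonneg[of u] by (simp add: a_def)
  have "list_norm (map ((*) a) u) = a * list_norm u"
    using a by (simp add: list_norm_def power_mult_distrib comp_def sum_list_const_mult real_sqrt_mult)
  moreover have "smat_vec S (map ((*) a) u) = a *\<^sub>R smat_vec S u"
    using assms by (simp add: smat_vec_def sum_list_sum_nth scaleR_sum_right)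
  ultimately have "a * norm (smat_vec S u) \<le> spectral_norm S"
    unfolding spectral_norm_def
    using assms a False by (intro cSUP_upper2[OF bdd_above_spectral_norm, where x = "map ((*) a) u"])
      (auto simp: a_def)
  then show ?thesis using False list_norm_nonneg[of u] by (simp add: a_def field_simps)
qed

lemma spectral_norm_nonneg: "0 \<le> spectral_norm S"
  unfolding spectral_norm_def
  by (rule cSUP_upper2[OF bdd_above_spectral_norm, where x = "replicate (length S) 0"])
    (auto simp: list_norm_zeros)

lemma inner_gram_le_spectral_norm: "y \<bullet> (gram S *v y) \<le> (spectral_norm S)\<^sup>2 * (norm y)\<^sup>2"
proof -
  let ?s = "list_norm (smat_tvec S y)"
  have "?s * ?s = y \<bullet> smat_vec S (smat_tvec S y)"
    using inner_gram[of y S] by (simp add: gram_mult_vec power2_eq_square)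
  also have "\<dots> \<le> norm y * norm (smat_vec S (smat_tvec S y))" by (rule norm_cauchy_schwarz)
  also have "\<dots> \<le> norm y * (spectral_norm S * ?s)"
    by (intro mult_left_mono norm_smat_vec_le_spectral_norm) auto
  finally have "?s * ?s \<le> (spectral_norm S * norm y) * ?s" by (simp add: algebra_simps)
  then have "?s \<le> spectral_norm S * norm y"
    using list_norm_nonneg[of "smat_tvec S y"] spectral_norm_nonneg[of S] by (cases "?s = 0") auto
  then show ?thesis
    unfolding inner_gram power_mult_distrib[symmetric]
    using list_norm_nonneg by (intro power_mono) auto
qed

text \<open>\<open>S\<close> and its transpose have the same operator bounds, so a sublevel set of
  the spectral norm is a condition on \<open>gram S\<close>.\<close>

lemma spectral_norm_le_iff:
  assumes "\<tau> \<ge> 0"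
  shows "spectral_norm S \<le> \<tau> \<longleftrightarrow> (\<forall>y. y \<bullet> (gram S *v y) \<le> \<tau>\<^sup>2 * (norm y)\<^sup>2)"
proof
  assume "spectral_norm S \<le> \<tau>"
  then have "(spectral_norm S)\<^sup>2 \<le> \<tau>\<^sup>2" using spectral_norm_nonneg by (intro power_mono) auto
  then show "\<forall>y. y \<bullet> (gram S *v y) \<le> \<tau>\<^sup>2 * (norm y)\<^sup>2"
    using inner_gram_le_spectral_norm by (meson mult_right_mono order_trans zero_le_power2)
next
  assume *: "\<forall>y. y \<bullet> (gram S *v y) \<le> \<tau>\<^sup>2 * (norm y)\<^sup>2"
  show "spectral_norm S \<le> \<tau>"
    unfolding spectral_norm_def
  proof (rule cSUP_least)
    show "{u. length u = length S \<and> list_norm u \<le> 1} \<noteq> {}"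
      using list_norm_zeros[of "length S"] by (auto intro!: exI[of _ "replicate (length S) 0"])
    fix u assume u: "u \<in> {u. length u = length S \<and> list_norm u \<le> 1}"
    then have "norm (smat_vec S u) \<le> \<tau> * list_norm u" using assms * by (intro norm_smat_vec_le) auto
    also have "\<dots> \<le> \<tau> * 1" using u assms by (intro mult_left_mono) auto
    finally show "norm (smat_vec S u) \<le> \<tau>" by simp
  qed
qed

text \<open>The sigma-algebra on the sampling matrices is arbitrary apart from making \<^const>\<open>gram\<close>
  measurable, hence the spectral norm has to be expressed through \<^const>\<open>gram\<close>.\<close>

lemma measurable_spectral_norm:
  fixes N :: "'m::finite smat measure"
  assumes [measurable]: "gram \<in> borel_measurable N"
  shows "spectral_norm \<in> borel_measurable N"
proof (rule borel_measurableI_le)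
  fix \<tau> :: real
  show "{S \<in> space N. spectral_norm S \<le> \<tau>} \<in> sets N"
  proof (cases "\<tau> \<ge> 0")
    case True
    \<comment> \<open>Each condition is linear in \<open>G\<close>, so \<open>C\<close> is an
      intersection of closed sets and therefore Borel.\<close>
    define C where "C = {G :: real^'m^'m. \<forall>y. y \<bullet> (G *v y) \<le> \<tau>\<^sup>2 * (norm y)\<^sup>2}"
    have [measurable]: "C \<in> sets borel"
      unfolding C_def Collect_all_eq matrix_vector_mult_def
      by (intro borel_closed closed_INT ballI closed_Collect_le continuous_intros)
    then have "{S \<in> space N. gram S \<in> C} \<in> sets N" by measurable
    then show ?thesis by (simp add: C_def spectral_norm_le_iff[OF True])
  next
    case False
    then have "{S \<in> space N. spectral_norm S \<le> \<tau>} = {}"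
      using spectral_norm_nonneg by (auto simp: not_le intro: less_le_trans)
    then show ?thesis by (simp only: sets.empty_sets)
  qed
qed

lemma inner_gram_le: "u \<bullet> (gram S *v v) \<le> list_norm (smat_tvec S u) * list_norm (smat_tvec S v)"
  using smat_vec_inner_le[of "smat_tvec S v" S u]
  by (simp add: gram_mult_vec inner_commute mult.commute)

text \<open>An entry is the Gram form at two unit vectors, to which Cauchy-Schwarz applies; flipping
  the sign of one of them yields the absolute value.\<close>

lemma abs_gram_nth_le: "\<bar>gram S $ i $ j\<bar> \<le> (spectral_norm S)\<^sup>2"
proof -
  have s: "list_norm (smat_tvec S u) \<le> spectral_norm S" if "norm u = 1" for u
    by (rule power2_le_imp_le)
      (use inner_gram_le_spectral_norm[of u S] that spectral_norm_nonneg in \<open>auto simp: inner_gram\<close>)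
  have b: "u \<bullet> (gram S *v v) \<le> (spectral_norm S)\<^sup>2" if "norm u = 1" "norm v = 1" for u v
    unfolding power2_eq_square
    using inner_gram_le[of u S v] mult_mono[OF s[OF that(1)] s[OF that(2)]]
      spectral_norm_nonneg[of S] list_norm_nonneg by (meson order_trans)
  show ?thesis
    using matrix_nth_inner[of "gram S" i j] b[of "axis i 1" "axis j 1"] b[of "- axis i 1" "axis j 1"] by (simp add: norm_axis_1 abs_le_iff)
qed

lemma norm_gram_le:
  "norm (gram S :: real^'m^'m) \<le> (real CARD('m))\<^sup>2 * (spectral_norm S)\<^sup>2"
proof -
  have "norm (gram S) \<le> (\<Sum>i\<in>UNIV. norm (gram S $ i))"
    unfolding norm_vec_def by (intro L2_set_le_sum) auto
  also have "\<dots> \<le> (\<Sum>i\<in>UNIV. \<Sum>j\<in>UNIV. \<bar>gram S $ i $ j\<bar>)"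
    by (intro sum_mono norm_le_l1_cart)
  also have "\<dots> \<le> (\<Sum>i\<in>(UNIV :: 'm set). \<Sum>j\<in>(UNIV :: 'm set). (spectral_norm S)\<^sup>2)"
    by (intro sum_mono abs_gram_nth_le)
  finally show ?thesis by (simp add: power2_eq_square)
qed

text \<open>A common weight for the bounded and the normalised case of \<^const>\<open>sampling_H\<close> and
  \<^const>\<open>sampling_lambda_max\<close>. The SDCD update is invariant under scaling of the sampling matrix,
  so both cases have the same analysis.\<close>

definition sampling_weight :: "'m::finite smat measure \<Rightarrow> 'm smat \<Rightarrow> real" where
  "sampling_weight P T = (if bounded_smats (space P) then 1 else inverse ((spectral_norm T)\<^sup>2))"

lemma sampling_H_eq: "sampling_H P = (\<integral>T. sampling_weight P T *\<^sub>R gram T \<partial>P)"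
  by (simp add: sampling_H_def sampling_weight_def)

lemma sampling_lambda_max_eq:
  "sampling_lambda_max A P =
     (SUP T\<in>space P. lambda_max (sampling_weight P T *\<^sub>R (transpose A ** gram T ** A)))"
  by (simp add: sampling_lambda_max_def sampling_weight_def)

lemma sampling_weight_nonneg: "0 \<le> sampling_weight P T"
  by (simp add: sampling_weight_def)

text \<open>The weight compensates for unbounded spectral norms: the normalised product is 1, or 0
  for a matrix of norm 0.\<close>

lemma sampling_weight_bound:
  obtains B where "B \<ge> 0" "\<And>T. T \<in> space P \<Longrightarrow> sampling_weight P T * (spectral_norm T)\<^sup>2 \<le> B"
proof (cases "bounded_smats (space P)")
  case True
  then obtain B where "\<And>T. T \<in> space P \<Longrightarrow> spectral_norm T \<le> B"
    by (auto simp: bounded_smats_def)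
  then have "sampling_weight P T * (spectral_norm T)\<^sup>2 \<le> B\<^sup>2" if "T \<in> space P" for T
    using True that spectral_norm_nonneg[of T] by (auto simp: sampling_weight_def intro!: power_mono)
  then show thesis by (intro that[of "B\<^sup>2"]) auto
next
  case False
  then show thesis by (intro that[of 1]) (auto simp: sampling_weight_def field_simps)
qed

text \<open>The weighted Gram matrices are uniformly bounded on the sample set, and a probability
  measure integrates bounded measurable functions.\<close>

lemma integrable_weighted_gram:
  fixes P :: "'m::finite smat measure"
  assumes "prob_space P" "integrable P gram"
  shows "integrable P (\<lambda>T. sampling_weight P T *\<^sub>R gram T)"
proof -
  interpret prob_space P by fact
  have [measurable]: "gram \<in> borel_measurable P" using assms(2) by simp
  note measurable_spectral_norm[OF this, measurable]
  obtain B where B: "B \<ge> 0" "\<And>T. T \<in> space P \<Longrightarrow> sampling_weight P T * (spectral_norm T)\<^sup>2 \<le> B"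
    by (rule sampling_weight_bound[of P]) blast
  have "norm (sampling_weight P T *\<^sub>R gram T) \<le> (real CARD('m))\<^sup>2 * B" if "T \<in> space P" for T
  proof -
    have "sampling_weight P T * norm (gram T)
        \<le> sampling_weight P T * ((real CARD('m))\<^sup>2 * (spectral_norm T)\<^sup>2)"
      by (intro mult_left_mono norm_gram_le sampling_weight_nonneg)
    also have "\<dots> = (real CARD('m))\<^sup>2 * (sampling_weight P T * (spectral_norm T)\<^sup>2)" by simp
    also have "\<dots> \<le> (real CARD('m))\<^sup>2 * B" using B(2)[OF that] by (intro mult_left_mono) auto
    finally show ?thesis by (simp add: sampling_weight_nonneg)
  qed
  moreover have "(\<lambda>T. sampling_weight P T *\<^sub>R gram T) \<in> borel_measurable P"
    unfolding sampling_weight_def by measurable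
  ultimately show ?thesis by (intro integrable_const_bound[of _ "(real CARD('m))\<^sup>2 * B"] AE_I2) auto
qed

context
  fixes A :: "real^'n^'m" and P :: "'m smat measure"
begin

lemma weighted_gram_compress:
  "v \<bullet> ((c *\<^sub>R (transpose A ** gram T ** A)) *v v) = c * ((A *v v) \<bullet> (gram T *v (A *v v)))"
proof -
  have "(c *\<^sub>R (transpose A ** gram T ** A)) *v v = c *\<^sub>R (transpose A *v (gram T *v (A *v v)))"
    by (simp only: scaleR_matrix_vector_assoc[symmetric] matrix_vector_mul_assoc matrix_mul_assoc)
  moreover have "v \<bullet> (transpose A *v (gram T *v (A *v v))) = (A *v v) \<bullet> (gram T *v (A *v v))"
    using transpose_vec_inner[of A "gram T *v (A *v v)" v] by (simp only: inner_commute)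
  ultimately show ?thesis by simp
qed

lemma transpose_weighted_gram_compress:
  "transpose (c *\<^sub>R (transpose A ** gram T ** A)) = c *\<^sub>R (transpose A ** gram T ** A)"
  by (simp add: transpose_scalar matrix_transpose_mul transpose_gram matrix_mul_assoc)

text \<open>The supremum bounds its members only if the family is bounded above. Evaluating the form
  at an eigenvector of the largest eigenvalue gives such a bound, uniform in
  \<open>T\<close>.\<close>

lemma gram_le_sampling_lambda_max:
  assumes "T \<in> space P"
  shows "sampling_weight P T * ((A *v v) \<bullet> (gram T *v (A *v v))) \<le> sampling_lambda_max A P * (norm v)\<^sup>2"
proof -
  let ?W = "\<lambda>T. sampling_weight P T *\<^sub>R (transpose A ** gram T ** A)"
  obtain B where B: "B \<ge> 0" "\<And>T. T \<in> space P \<Longrightarrow> sampling_weight P T * (spectral_norm T)\<^sup>2 \<le> B"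
    by (rule sampling_weight_bound[of P]) blast
  obtain K where K: "\<And>v. norm (A *v v) \<le> norm v * K"
    using bounded_linear.bounded[OF matrix_vector_mul_bounded_linear[of A]] by blast
  have "bdd_above ((\<lambda>T. lambda_max (?W T)) ` space P)"
  proof (rule bdd_aboveI2)
    fix T assume T: "T \<in> space P"
    obtain v where v: "v \<noteq> 0" "?W T *v v = lambda_max (?W T) *\<^sub>R v"
      using lambda_max_eigenvalue[OF transpose_weighted_gram_compress] by (auto simp: eigenvalues_def)
    have "lambda_max (?W T) * (norm v)\<^sup>2 = v \<bullet> (?W T *v v)"
      unfolding v(2) by (simp add: power2_norm_eq_inner)
    also have "\<dots> \<le> sampling_weight P T * ((spectral_norm T)\<^sup>2 * (norm (A *v v))\<^sup>2)"
      unfolding weighted_gram_compress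
      by (intro mult_left_mono inner_gram_le_spectral_norm sampling_weight_nonneg)
    also have "\<dots> \<le> B * (norm v * K)\<^sup>2"
      unfolding mult.assoc[symmetric]
      using B(2)[OF T] B(1) K[of v] by (intro mult_mono power_mono) auto
    finally have "lambda_max (?W T) * (norm v)\<^sup>2 \<le> (B * K\<^sup>2) * (norm v)\<^sup>2"
      by (simp add: power_mult_distrib algebra_simps)
    then show "lambda_max (?W T) \<le> B * K\<^sup>2" using v(1) by simp
  qed
  then have "lambda_max (?W T) \<le> sampling_lambda_max A P"
    unfolding sampling_lambda_max_eq using assms by (rule cSUP_upper[rotated])
  then have "lambda_max (?W T) * (norm v)\<^sup>2 \<le> sampling_lambda_max A P * (norm v)\<^sup>2"
    by (intro mult_right_mono) auto
  then show ?thesis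
    using le_lambda_max[OF transpose_weighted_gram_compress, of v "sampling_weight P T" T]
    unfolding weighted_gram_compress by linarith
qed

lemma sampling_lambda_max_nonneg:
  assumes "space P \<noteq> {}"
  shows "0 \<le> sampling_lambda_max A P"
proof -
  obtain T where "T \<in> space P" using assms by blast
  \<comment> \<open>Any unit vector would do; \<open>undefined\<close> only names some
    index.\<close>
  from gram_le_sampling_lambda_max[OF this, of "axis undefined 1"]
  show ?thesis
    using mult_nonneg_nonneg[OF sampling_weight_nonneg inner_gram_nonneg]
    by (fastforce simp: norm_axis_1 intro: order_trans)
qed

text \<open>With \<open>t\<close> the search direction, \<open>(norm t)\<^sup>2\<close> is the Gram
  form at \<open>A *v t\<close> and \<open>r\<close>. Cauchy-Schwarz for this form and the bound on
  its value at \<open>A *v t\<close> leave a factor \<open>(norm t)\<^sup>2\<close> to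
  cancel.\<close>

lemma weighted_direction_le:
  assumes "T \<in> space P"
  shows "sampling_weight P T * (norm (transpose A *v (gram T *v r)))\<^sup>2
           \<le> sampling_lambda_max A P * (r \<bullet> (gram T *v r))"
proof (cases "transpose A *v (gram T *v r) = 0")
  case True
  then show ?thesis
    using mult_nonneg_nonneg[OF sampling_lambda_max_nonneg inner_gram_nonneg[of r T]] assms by auto
next
  case False
  define t where "t = transpose A *v (gram T *v r)"
  let ?q = "r \<bullet> (gram T *v r)"
  have "(norm t)\<^sup>2 = (A *v t) \<bullet> (gram T *v r)"
    using transpose_vec_inner[of A "gram T *v r" t]
    by (simp only: t_def power2_norm_eq_inner inner_commute)
  then have "((norm t)\<^sup>2)\<^sup>2 \<le> (list_norm (smat_tvec T (A *v t)) * list_norm (smat_tvec T r))\<^sup>2"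
    using inner_gram_le by (metis power_mono zero_le_power2)
  then have "(norm t)\<^sup>2 * (norm t)\<^sup>2 \<le> ((A *v t) \<bullet> (gram T *v (A *v t))) * ?q"
    by (simp only: inner_gram power_mult_distrib power2_eq_square[symmetric])
  then have "sampling_weight P T * ((norm t)\<^sup>2 * (norm t)\<^sup>2)
      \<le> sampling_weight P T * (((A *v t) \<bullet> (gram T *v (A *v t))) * ?q)"
    by (intro mult_left_mono sampling_weight_nonneg)
  also have "\<dots> \<le> (sampling_lambda_max A P * (norm t)\<^sup>2) * ?q"
    unfolding mult.assoc[symmetric]
    by (intro mult_right_mono gram_le_sampling_lambda_max assms inner_gram_nonneg)
  finally have "(sampling_weight P T * (norm t)\<^sup>2) * (norm t)\<^sup>2 \<le> (sampling_lambda_max A P * ?q) * (norm t)\<^sup>2"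
    by (simp add: algebra_simps)
  moreover have "t \<noteq> 0" using False by (simp only: t_def not_False_eq_True)
  ultimately have "sampling_weight P T * (norm t)\<^sup>2 \<le> sampling_lambda_max A P * ?q" by simp
  then show ?thesis by (simp only: t_def)
qed

end

section \<open>Descent of the Bregman distance\<close>

text \<open>When \<open>S\<^sup>T r = 0\<close> the case distinction in the step size is absorbed by \<open>0 / 0 = 0\<close>.\<close>

lemma sdcd_update_eq:
  "sdcd_update \<gamma> \<zeta> A b T x z =
     z - ((2 - \<zeta>) * \<gamma> * ((A *v x - b) \<bullet> (gram T *v (A *v x - b)))
            / (norm (transpose A *v (gram T *v (A *v x - b))))\<^sup>2)
         *\<^sub>R (transpose A *v (gram T *v (A *v x - b)))"
  by (simp add: sdcd_update_def sdcd_step_size_def L_adap_def Let_def smat_tvec_eq_zero_iff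
      gram_mult_vec[symmetric] inner_gram[symmetric] del: transpose_matrix_vector)

text \<open>The estimate holds for each sample \<open>T\<close> and each dual point
  \<open>z\<close>, so it serves both along the trajectories and for a trial step from the starting
  point.\<close>

lemma sdcd_descent:
  fixes A :: "real^'n^'m" and P :: "'m smat measure" and f :: "real^'n \<Rightarrow> real"
    and b :: "real^'m" and xhat :: "real^'n"
  defines "D \<equiv> \<lambda>w. bregman f w (gradient (conjugate f) w) xhat"
  defines "r \<equiv> \<lambda>w. A *v gradient (conjugate f) w - b"
  assumes sc: "strongly_convex \<gamma> f" and \<gamma>: "\<gamma> > 0" and \<zeta>: "0 < \<zeta>" "\<zeta> < 2"
    and xhat: "A *v xhat = b" and T: "T \<in> space P"
  shows "D (sdcd_update \<gamma> \<zeta> A b T (gradient (conjugate f) z) z)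
    \<le> D z - \<gamma> * \<zeta> * (2 - \<zeta>) / 2 *
         (sampling_weight P T * (r z \<bullet> (gram T *v r z)) / sampling_lambda_max A P)"
proof -
  define x where "x = gradient (conjugate f) z"
  define t where "t = transpose A *v (gram T *v r z)"
  define q where "q = r z \<bullet> (gram T *v r z)"
  define n where "n = (norm t)\<^sup>2"
  define \<alpha> where "\<alpha> = (2 - \<zeta>) * \<gamma> * q / n"
  define z' where "z' = sdcd_update \<gamma> \<zeta> A b T x z"
  have z': "z' = z - \<alpha> *\<^sub>R t"
    unfolding z'_def sdcd_update_eq by (simp add: \<alpha>_def n_def q_def t_def r_def x_def)
  have tx: "t \<bullet> (x - xhat) = q"
    using transpose_vec_inner[of A "gram T *v r z" "x - xhat"] xhat
    by (simp add: t_def q_def r_def x_def matrix_vector_mult_diff_distrib inner_commute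
        del: transpose_matrix_vector)
  have "D z' \<le> D z + x \<bullet> (z' - z) + (norm (z' - z))\<^sup>2 / (2 * \<gamma>) - (z' - z) \<bullet> xhat"
    using conjugate_bounds(2)[OF sc \<gamma> gradient_conjugate_subdiff[OF sc \<gamma>], of z' z]
    unfolding D_def bregman_conjugate[OF sc \<gamma>] x_def by (simp add: inner_diff_left)
  also have "\<dots> = D z - \<alpha> * (t \<bullet> (x - xhat)) + \<alpha>\<^sup>2 * n / (2 * \<gamma>)"
    by (simp add: z' n_def power_mult_distrib inner_diff_right inner_commute[of x t] algebra_simps)
  \<comment> \<open>Inserting \<alpha> gives \<open>(2 - \<zeta>) * \<gamma> * q\<^sup>2 / n\<close>
    times \<open>(2 - \<zeta>) / 2 - 1 = - \<zeta> / 2\<close>. For \<open>n = 0\<close> both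
    corrections vanish because division by 0 yields 0.\<close>
  also have "\<dots> = D z - \<gamma> * \<zeta> * (2 - \<zeta>) / 2 * (q\<^sup>2 / n)"
    unfolding tx \<alpha>_def using \<gamma> by (cases "n = 0") (simp_all add: field_simps power2_eq_square)
  also have "\<dots> \<le> D z - \<gamma> * \<zeta> * (2 - \<zeta>) / 2 * (sampling_weight P T * q / sampling_lambda_max A P)"
  proof -
    let ?\<Lambda> = "sampling_lambda_max A P" and ?w = "sampling_weight P T"
    have \<Lambda>: "?\<Lambda> \<ge> 0" using T by (intro sampling_lambda_max_nonneg) blast
    have q: "q \<ge> 0" by (simp add: q_def inner_gram_nonneg)
    \<comment> \<open>Both degenerate cases are harmless: a quotient by \<open>?\<Lambda> = 0\<close> vanishes, and \<open>t = 0\<close> forces \<open>q = 0\<close>.\<close>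
    have "?w * q / ?\<Lambda> \<le> q\<^sup>2 / n"
    proof (cases "?\<Lambda> = 0 \<or> t = 0")
      case True
      then show ?thesis using tx q by (auto simp: n_def)
    next
      case False
      have "?w * n \<le> ?\<Lambda> * q" unfolding n_def t_def q_def by (rule weighted_direction_le[OF T])
      then have "?w * n * q \<le> ?\<Lambda> * q * q" using q by (rule mult_right_mono)
      moreover have "?\<Lambda> > 0" "n > 0" using False \<Lambda> by (auto simp: n_def)
      ultimately show ?thesis by (simp add: field_simps power2_eq_square)
    qed
    then show ?thesis using \<gamma> \<zeta> by (intro diff_left_mono mult_left_mono) auto
  qed
  finally show ?thesis by (simp only: z'_def x_def q_def)
qed

section \<open>Conditional expectation over a fresh sample\<close>

lemma bounded_linear_quadratic_form: "bounded_linear (\<lambda>G :: real^'m^'n. u \<bullet> (G *v v))"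
  by (auto simp: linear_conv_bounded_linear[symmetric] linear_iff matrix_vector_mult_add_rdistrib
      inner_add_right scaleR_matrix_vector_assoc[symmetric])

lemma inner_integral_matrix:
  fixes G :: "'a \<Rightarrow> real^'m^'n"
  assumes "integrable M G"
  shows "integrable M (\<lambda>\<omega>. u \<bullet> (G \<omega> *v v))"
    and "u \<bullet> ((\<integral>\<omega>. G \<omega> \<partial>M) *v v) = (\<integral>\<omega>. u \<bullet> (G \<omega> *v v) \<partial>M)"
  using integrable_bounded_linear[OF bounded_linear_quadratic_form assms]
    integral_bounded_linear[OF bounded_linear_quadratic_form assms] by auto

lemma measurable_matrix_vector_mult [measurable (raw)]:
  fixes G :: "'a \<Rightarrow> real^'m^'n"
  assumes "G \<in> borel_measurable M" "v \<in> borel_measurable M"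
  shows "(\<lambda>\<omega>. G \<omega> *v v \<omega>) \<in> borel_measurable M"
proof -
  have "continuous_on UNIV (\<lambda>p :: (real^'m^'n) \<times> (real^'m). fst p *v snd p)"
    unfolding matrix_vector_mult_def by (intro continuous_intros)
  then show ?thesis by (rule borel_measurable_continuous_Pair[OF assms])
qed

lemma measurable_vec_nth [measurable (raw)]:
  fixes v :: "'a \<Rightarrow> ('b::real_normed_vector)^'n"
  assumes "v \<in> borel_measurable M"
  shows "(\<lambda>\<omega>. v \<omega> $ i) \<in> borel_measurable M"
  using assms by (rule borel_measurable_continuous_on[rotated]) (intro continuous_intros)

text \<open>The sigma-algebras generated by \<open>U\<close> and \<open>V\<close> lie inside
  \<open>F\<close> and \<open>F'\<close>, and independence passes to subfamilies.\<close>

lemma (in prob_space) indep_var_subalgebras: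
  assumes "indep_set (sets F) (sets F')" "subalgebra M F" "subalgebra M F'"
    and "U \<in> measurable F N" "V \<in> measurable F' N'"
  shows "indep_var N U N' V"
proof -
  have sub: "sigma_sets (space M) {U -` B \<inter> space M |B. B \<in> sets N} \<subseteq> sets F"
    if "subalgebra M F" "U \<in> measurable F N" for F N and U :: "'a \<Rightarrow> 'z"
    using that sets.sigma_sets_subset[of "{U -` B \<inter> space M |B. B \<in> sets N}" F] measurable_sets[of U F N]
    by (fastforce simp: subalgebra_def)
  have "U \<in> measurable M N" "V \<in> measurable M N'"
    using assms by (auto intro: measurable_from_subalg)
  moreover have "indep_set (sigma_sets (space M) {U -` B \<inter> space M |B. B \<in> sets N})
      (sigma_sets (space M) {V -` B \<inter> space M |B. B \<in> sets N'})"
    using assms(1) sub[OF assms(2,4)] sub[OF assms(3,5)] unfolding indep_sets2_eq by blast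
  ultimately show ?thesis unfolding indep_var_eq by blast
qed

text \<open>In coordinates the form is a sum of products of a bounded \<open>F\<close>-measurable
  factor and an independent entry of \<open>G\<close>. Expectations of such products factor on every
  test set of \<open>F\<close>, which characterizes the conditional expectation.\<close>

lemma (in prob_space) real_cond_exp_quadratic_form:
  fixes G :: "'a \<Rightarrow> real^'m^'m" and r :: "'a \<Rightarrow> real^'m"
  assumes indep: "indep_set (sets F) (sets F')" and F: "subalgebra M F" and F': "subalgebra M F'"
    and r: "r \<in> borel_measurable F" "\<And>\<omega>. \<omega> \<in> space M \<Longrightarrow> norm (r \<omega>) \<le> K"
    and G: "G \<in> borel_measurable F'" "integrable M G"
  shows "integrable M (\<lambda>\<omega>. r \<omega> \<bullet> (G \<omega> *v r \<omega>))"
    and "AE \<omega> in M. real_cond_exp M F (\<lambda>\<omega>. r \<omega> \<bullet> (G \<omega> *v r \<omega>)) \<omega>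
           = r \<omega> \<bullet> ((\<integral>\<omega>. G \<omega> \<partial>M) *v r \<omega>)"
proof -
  interpret finite_measure_subalgebra M F by unfold_locales (rule F)
  let ?H = "\<integral>\<omega>. G \<omega> \<partial>M"
  have expand: "u \<bullet> (X *v u) = (\<Sum>i\<in>UNIV. \<Sum>j\<in>UNIV. (u $ i * u $ j) * X $ i $ j)"
    for u and X :: "real^'m^'m"
    by (simp add: inner_vec_def matrix_vector_mult_def sum_distrib_left algebra_simps)
  have [measurable]: "r \<in> borel_measurable M" by (rule measurable_from_subalg[OF F r(1)])
  have Gij: "integrable M (\<lambda>\<omega>. G \<omega> $ i $ j)" "(\<integral>\<omega>. G \<omega> $ i $ j \<partial>M) = ?H $ i $ j" for i j
    using inner_integral_matrix[OF G(2), of "axis i 1" "axis j 1"]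
    by (simp_all only: matrix_nth_inner[symmetric])
  \<comment> \<open>The indicator belongs to the \<open>F\<close>-measurable factor, so one
    independence argument covers all test sets; \<open>A = space M\<close> gives plain
    integrability.\<close>
  have prod: "integrable M (\<lambda>\<omega>. (indicator A \<omega> * (r \<omega> $ i * r \<omega> $ j)) * G \<omega> $ i $ j)"
      "(\<integral>\<omega>. (indicator A \<omega> * (r \<omega> $ i * r \<omega> $ j)) * G \<omega> $ i $ j \<partial>M)
        = (\<integral>\<omega>. indicator A \<omega> * (r \<omega> $ i * r \<omega> $ j) \<partial>M) * ?H $ i $ j"
      "integrable M (\<lambda>\<omega>. indicator A \<omega> * (r \<omega> $ i * r \<omega> $ j))"
    if A: "A \<in> sets F" for A i j
  proof -
    let ?U = "\<lambda>\<omega>. indicator A \<omega> * (r \<omega> $ i * r \<omega> $ j)"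
    have UF: "?U \<in> borel_measurable F" using A r(1) by measurable
    have "norm (?U \<omega>) \<le> K * K" if "\<omega> \<in> space M" for \<omega>
    proof -
      have le: "\<bar>r \<omega> $ l\<bar> \<le> K" for l
        using component_le_norm_cart r(2)[OF that] by (rule order_trans)
      then have "K \<ge> 0" by (meson abs_ge_zero order_trans)
      then show ?thesis
        using mult_mono[OF le[of i] le[of j]] by (auto simp: indicator_def abs_mult)
    qed
    then show U: "integrable M ?U"
      using measurable_from_subalg[OF F UF] by (intro integrable_const_bound[of _ "K * K"] AE_I2)
    have "indep_var borel ?U borel (\<lambda>\<omega>. G \<omega> $ i $ j)"
      using G(1) by (intro indep_var_subalgebras[OF indep F F'] UF) measurable
    from indep_var_integrable[OF this U Gij(1)] indep_var_lebesgue_integral[OF this U Gij(1)]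
    show "integrable M (\<lambda>\<omega>. ?U \<omega> * G \<omega> $ i $ j)"
      "(\<integral>\<omega>. ?U \<omega> * G \<omega> $ i $ j \<partial>M) = (\<integral>\<omega>. ?U \<omega> \<partial>M) * ?H $ i $ j"
      by (simp_all only: Gij(2))
  qed
  have full: "space M \<in> sets F" using F by (metis sets.top subalgebra_def)
  have int: "integrable M (\<lambda>\<omega>. (r \<omega> $ i * r \<omega> $ j) * G \<omega> $ i $ j)" for i j
    using prod(1)[OF full, of i j]
    by (rule Bochner_Integration.integrable_cong[OF refl, THEN iffD1, rotated]) simp
  have int': "integrable M (\<lambda>\<omega>. r \<omega> $ i * r \<omega> $ j)" for i j
    using prod(3)[OF full, of i j]
    by (rule Bochner_Integration.integrable_cong[OF refl, THEN iffD1, rotated]) simp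
  show 1: "integrable M (\<lambda>\<omega>. r \<omega> \<bullet> (G \<omega> *v r \<omega>))"
    unfolding expand by (intro Bochner_Integration.integrable_sum int)
  show "AE \<omega> in M. real_cond_exp M F (\<lambda>\<omega>. r \<omega> \<bullet> (G \<omega> *v r \<omega>)) \<omega> = r \<omega> \<bullet> (?H *v r \<omega>)"
  proof (rule real_cond_exp_charact[OF _ 1])
    show "integrable M (\<lambda>\<omega>. r \<omega> \<bullet> (?H *v r \<omega>))"
      unfolding expand by (intro Bochner_Integration.integrable_sum integrable_mult_left int')
    show "(\<lambda>\<omega>. r \<omega> \<bullet> (?H *v r \<omega>)) \<in> borel_measurable F" using r(1) by measurable
    fix A assume A: "A \<in> sets F"
    have pull: "indicator A \<omega> *\<^sub>R (u \<bullet> (X *v u))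
        = (\<Sum>i\<in>UNIV. \<Sum>j\<in>UNIV. (indicator A \<omega> * (u $ i * u $ j)) * X $ i $ j)"
      for \<omega> u and X :: "real^'m^'m"
      by (simp add: expand sum_distrib_left mult.assoc)
    have "(\<integral>\<omega>\<in>A. r \<omega> \<bullet> (G \<omega> *v r \<omega>) \<partial>M)
        = (\<Sum>i\<in>UNIV. \<Sum>j\<in>UNIV. (\<integral>\<omega>. indicator A \<omega> * (r \<omega> $ i * r \<omega> $ j) \<partial>M) * ?H $ i $ j)"
      unfolding set_lebesgue_integral_def pull
      by (simp only: Bochner_Integration.integral_sum Bochner_Integration.integrable_sum prod[OF A])
    also have "\<dots> = (\<integral>\<omega>\<in>A. r \<omega> \<bullet> (?H *v r \<omega>) \<partial>M)"
      unfolding set_lebesgue_integral_def pull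
      by (simp only: Bochner_Integration.integral_sum Bochner_Integration.integrable_sum
          integrable_mult_left integral_mult_left_zero prod(3)[OF A])
    finally show "(\<integral>\<omega>\<in>A. r \<omega> \<bullet> (G \<omega> *v r \<omega>) \<partial>M) = (\<integral>\<omega>\<in>A. r \<omega> \<bullet> (?H *v r \<omega>) \<partial>M)" .
  qed
qed

lemma subalgebra_vimage_algebra:
  assumes "X \<in> measurable M N"
  shows "subalgebra M (vimage_algebra (space M) X N)"
  unfolding subalgebra_def sets_vimage_algebra
  using assms by (auto intro!: sets.sigma_sets_subset simp: measurable_sets)

context prob_space
begin

context
  fixes P :: "nat \<Rightarrow> 'b measure" and S :: "nat \<Rightarrow> 'a \<Rightarrow> 'b"
  assumes indep: "indep_vars P S UNIV"
begin

lemma measurable_sample: "S i \<in> measurable M (P i)"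
  using indep by (simp add: indep_vars_def)

lemma subalgebra_history: "subalgebra M (history M P S k)"
  unfolding history_def
  by (intro subalgebra_vimage_algebra measurable_restrict measurable_sample)

text \<open>A sample is a coordinate of the tuple generating the sigma-algebra. Used with
  \<open>J = {..<k}\<close> for the past and \<open>J = {k}\<close> for the fresh sample.\<close>

lemma measurable_sample_vimage_algebra:
  assumes "i \<in> J"
  shows "S i \<in> measurable (vimage_algebra (space M) (\<lambda>\<omega>. \<lambda>i\<in>J. S i \<omega>) (PiM J P)) (P i)"
    (is "_ \<in> measurable ?V _")
proof -
  have "(\<lambda>\<omega>. \<lambda>i\<in>J. S i \<omega>) \<in> measurable ?V (PiM J P)"
    using measurable_space[OF measurable_sample]
    by (intro measurable_vimage_algebra1) (auto simp: space_PiM)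
  then have "(\<lambda>\<omega>. (\<lambda>i\<in>J. S i \<omega>) i) \<in> measurable ?V (P i)"
    by (rule measurable_compose[OF _ measurable_component_singleton[OF assms]])
  then show ?thesis using assms by simp
qed

text \<open>Disjoint index blocks are independent. The second block is a one-element tuple, whose
  sigma-algebra contains the one generated by \<open>S k\<close>.\<close>

lemma indep_set_history:
  "indep_set (sets (history M P S k)) (sets (vimage_algebra (space M) (S k) (P k)))"
proof -
  let ?V = "vimage_algebra (space M) (\<lambda>\<omega>. \<lambda>i\<in>{k}. S i \<omega>) (PiM {k} P)"
  have "indep_var (PiM {..<k} P) (\<lambda>\<omega>. \<lambda>i\<in>{..<k}. S i \<omega>) (PiM {k} P) (\<lambda>\<omega>. \<lambda>i\<in>{k}. S i \<omega>)"
    by (rule indep_var_restrict[OF indep]) auto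
  then have "indep_set (sets (history M P S k)) (sets ?V)"
    unfolding indep_var_eq history_def sets_vimage_algebra by blast
  moreover have "sets (vimage_algebra (space M) (S k) (P k)) \<subseteq> sets ?V"
    using subalgebra_vimage_algebra[OF measurable_sample_vimage_algebra[of k "{k}"]]
    by (simp add: subalgebra_def)
  ultimately show ?thesis unfolding indep_sets2_eq by blast
qed

end

end

section \<open>The expected Gram matrix and convergence\<close>

lemma sampling_H_form:
  fixes P :: "'m::finite smat measure"
  assumes "prob_space P" "integrable P gram"
  shows "u \<bullet> (sampling_H P *v v) = (\<integral>T. sampling_weight P T * (u \<bullet> (gram T *v v)) \<partial>P)"
    and "integrable P (\<lambda>T. sampling_weight P T * (u \<bullet> (gram T *v v)))"
  using inner_integral_matrix[OF integrable_weighted_gram[OF assms], of u v]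
  by (simp_all add: sampling_H_eq scaleR_matrix_vector_assoc[symmetric])

text \<open>The integral inherits symmetry from each \<open>gram T\<close>; this opens the
  eigenvalue bounds for \<open>sampling_H P\<close>.\<close>

lemma sampling_H_symmetric:
  fixes P :: "'m::finite smat measure"
  assumes "prob_space P" "integrable P gram"
  shows "transpose (sampling_H P) = sampling_H P"
proof -
  have "u \<bullet> (sampling_H P *v v) = v \<bullet> (sampling_H P *v u)" for u v
    unfolding sampling_H_form[OF assms]
    by (simp only: symmetric_inner[OF transpose_gram, symmetric] inner_commute[of _ u])
  then show ?thesis
    unfolding vec_eq_iff transpose_def by (simp add: matrix_nth_inner)
qed

text \<open>At an eigenvector the form of \<open>sampling_H P\<close> is a mean of nonnegative
  numbers.\<close>

lemma lambda_min_sampling_H_nonneg: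
  fixes P :: "'m::finite smat measure"
  assumes "prob_space P" "integrable P gram"
  shows "0 \<le> lambda_min (sampling_H P)"
proof -
  obtain v where v: "v \<noteq> 0" "sampling_H P *v v = lambda_min (sampling_H P) *\<^sub>R v"
    using lambda_min_eigenvalue[OF sampling_H_symmetric[OF assms]] by (auto simp: eigenvalues_def)
  have "0 \<le> v \<bullet> (sampling_H P *v v)"
    unfolding sampling_H_form[OF assms]
    by (intro integral_nonneg_AE AE_I2 mult_nonneg_nonneg sampling_weight_nonneg inner_gram_nonneg)
  then show ?thesis using v by (simp add: zero_le_mult_iff flip: power2_norm_eq_inner)
qed

text \<open>Turns the mean decrease into a contraction: the eigenvalue bound for \<open>r\<close> is
  chained with the error bound \<open>\<nu> * d \<le> (norm r)\<^sup>2\<close>.\<close>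

lemma contraction_factor_bound:
  fixes A :: "real^'n^'m" and P :: "'m smat measure"
  assumes P: "prob_space P" "integrable P gram"
    and pos: "\<gamma> > 0" "0 < \<zeta>" "\<zeta> < 2" "\<nu> > 0" and d: "\<nu> * d \<le> (norm r)\<^sup>2"
  shows "d - \<gamma> * \<zeta> * (2 - \<zeta>) / 2 * (r \<bullet> (sampling_H P *v r) / sampling_lambda_max A P)
    \<le> contraction_factor \<gamma> \<zeta> \<nu> A P * d"
proof -
  let ?l = "lambda_min (sampling_H P)" and ?\<Lambda> = "sampling_lambda_max A P"
  have "?\<Lambda> \<ge> 0" using prob_space.not_empty[OF P(1)] by (rule sampling_lambda_max_nonneg)
  moreover have "?l * (\<nu> * d) \<le> r \<bullet> (sampling_H P *v r)"
    using mult_left_mono[OF d lambda_min_sampling_H_nonneg[OF P]]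
      lambda_min_le[OF sampling_H_symmetric[OF P], of r] by linarith
  ultimately have "?l * (\<nu> * d) / ?\<Lambda> \<le> r \<bullet> (sampling_H P *v r) / ?\<Lambda>"
    by (rule divide_right_mono[rotated])
  then have "\<gamma> * \<zeta> * (2 - \<zeta>) / 2 * (?l * (\<nu> * d) / ?\<Lambda>)
      \<le> \<gamma> * \<zeta> * (2 - \<zeta>) / 2 * (r \<bullet> (sampling_H P *v r) / ?\<Lambda>)"
    using pos by (intro mult_left_mono) auto
  moreover have "contraction_factor \<gamma> \<zeta> \<nu> A P * d = d - \<gamma> * \<zeta> * (2 - \<zeta>) / 2 * (?l * (\<nu> * d) / ?\<Lambda>)"
    unfolding contraction_factor_def left_diff_distrib by simp
  ultimately show ?thesis by linarith
qed

theorem theorem3p6: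
  fixes A :: "real^'n^'m" and b :: "real^'m"
    and f :: "real^'n \<Rightarrow> real" and xhat :: "real^'n"
    and \<gamma> \<zeta> \<nu> :: real
    and P :: "nat \<Rightarrow> 'm smat measure"
    and M :: "'w measure" and S :: "nat \<Rightarrow> 'w \<Rightarrow> 'm smat"
    and z0 :: "real^'n" and x z :: "nat \<Rightarrow> 'w \<Rightarrow> real^'n"
  assumes consistent: "\<exists>u. A *v u = b"
    and gamma_pos: "\<gamma> > 0"
    and strongly_convex_f: "strongly_convex \<gamma> f"
    and admissible: "strongly_admissible TYPE('m) f"
    and xhat: "is_arg_min f (\<lambda>u. A *v u = b) xhat"
    and nu_pos: "\<nu> > 0"
    and nu: "\<forall>u. \<forall>w \<in> subdiff f u \<inter> range ((*v) (transpose A)).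
               bregman f w u xhat \<le> 1 / \<nu> * (norm (A *v (u - xhat)))\<^sup>2"
    and P_prob: "\<And>k. prob_space (P k)"
    and gram_integrable: "\<And>k. integrable (P k) gram"
    and gram_posdef: "\<And>k. positive_definite (\<integral>T. gram T \<partial>P k)"
    and zeta: "0 < \<zeta>" "\<zeta> < 2"
    and M_prob: "prob_space M"
    and S_distr: "\<And>k. distr M (P k) (S k) = P k"
    and S_indep: "prob_space.indep_vars M P S UNIV"
    and z0: "z0 \<in> range ((*v) (transpose A))"
    and z_0: "\<And>\<omega>. \<omega> \<in> space M \<Longrightarrow> z 0 \<omega> = z0"
    and z_Suc: "\<And>k \<omega>. \<omega> \<in> space M \<Longrightarrow>
                  z (Suc k) \<omega> = sdcd_update \<gamma> \<zeta> A b (S k \<omega>) (x k \<omega>) (z k \<omega>)"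
    and x_def: "\<And>k \<omega>. \<omega> \<in> space M \<Longrightarrow> x k \<omega> = gradient (conjugate f) (z k \<omega>)"
  shows "(\<forall>k. integrable M (\<lambda>\<omega>. bregman f (z (Suc k) \<omega>) (x (Suc k) \<omega>) xhat) \<and>
            (AE \<omega> in M.
               real_cond_exp M (history M P S k)
                 (\<lambda>\<omega>. bregman f (z (Suc k) \<omega>) (x (Suc k) \<omega>) xhat) \<omega>
               \<le> contraction_factor \<gamma> \<zeta> \<nu> A (P k) * bregman f (z k \<omega>) (x k \<omega>) xhat)) \<and>
         (\<forall>k. integrable M (\<lambda>\<omega>. (norm (x k \<omega> - xhat))\<^sup>2) \<and>
            (\<integral>\<omega>. (norm (x k \<omega> - xhat))\<^sup>2 \<partial>M)
            \<le> 2 * bregman f z0 (gradient (conjugate f) z0) xhat / \<gamma> *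
               (\<Prod>i<k. contraction_factor \<gamma> \<zeta> \<nu> A (P i)))"
proof -
  interpret prob_space M by (rule M_prob)
  note sc = strongly_convex_f and \<gamma> = gamma_pos
  have xhat_feasible: "A *v xhat = b" using xhat by (simp add: is_arg_min_def)

  \<comment> \<open>Deterministic estimates in the dual variable\<close>
  define X where "X = gradient (conjugate f)"
  define D where "D w = bregman f w (X w) xhat" for w
  define r where "r w = A *v X w - b" for w
  define \<kappa> where "\<kappa> = \<gamma> * \<zeta> * (2 - \<zeta>) / 2"
  define \<Lambda> where "\<Lambda> k = sampling_lambda_max A (P k)" for k
  define c where "c k = contraction_factor \<gamma> \<zeta> \<nu> A (P k)" for k
  have \<kappa>: "\<kappa> \<ge> 0" using \<gamma> zeta by (simp add: \<kappa>_def)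
  have \<Lambda>: "\<Lambda> k \<ge> 0" for k
    unfolding \<Lambda>_def using prob_space.not_empty[OF P_prob] by (rule sampling_lambda_max_nonneg)

  have D_lower: "\<gamma> / 2 * (norm (X w - xhat))\<^sup>2 \<le> D w" for w
    unfolding D_def X_def by (rule bregman_lower_bound[OF sc \<gamma>])
  have D_nonneg: "0 \<le> D w" for w
    by (rule order_trans[OF _ D_lower]) (use \<gamma> in simp)
  have dist_le: "(norm (X w - xhat))\<^sup>2 \<le> 2 / \<gamma> * D w" for w
    using D_lower[of w] \<gamma> by (simp add: field_simps)
  have r_eq: "r w = A *v (X w - xhat)" for w
    by (simp add: r_def xhat_feasible matrix_vector_mult_diff_distrib)
  have D_upper: "\<nu> * D w \<le> (norm (r w))\<^sup>2" if "w \<in> range ((*v) (transpose A))" for w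
    using nu that gradient_conjugate_subdiff[OF sc \<gamma>, of w] nu_pos
    by (auto simp: D_def X_def[symmetric] r_eq field_simps)
  have descent: "D (sdcd_update \<gamma> \<zeta> A b T (X w) w)
      \<le> D w - \<kappa> * (sampling_weight (P k) T * (r w \<bullet> (gram T *v r w)) / \<Lambda> k)"
    if "T \<in> space (P k)" for k T w
    unfolding D_def X_def r_def \<kappa>_def \<Lambda>_def by (rule sdcd_descent[OF sc \<gamma> zeta xhat_feasible that])
  have gain_nonneg: "0 \<le> \<kappa> * (sampling_weight (P k) T * (r w \<bullet> (gram T *v r w)) / \<Lambda> k)" for k T w
    by (intro mult_nonneg_nonneg divide_nonneg_nonneg \<kappa> \<Lambda> sampling_weight_nonneg inner_gram_nonneg)
  have contraction: "D w - \<kappa> * (r w \<bullet> (sampling_H (P k) *v r w) / \<Lambda> k) \<le> c k * D w"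
    if "w \<in> range ((*v) (transpose A))" for k w
    unfolding \<kappa>_def \<Lambda>_def c_def
    by (rule contraction_factor_bound[OF P_prob gram_integrable \<gamma> zeta nu_pos D_upper[OF that]])

  \<comment> \<open>Pathwise properties of the iterates\<close>
  have S_meas: "S k \<in> measurable M (P k)" for k by (rule measurable_sample[OF S_indep])
  have S_space: "S k \<omega> \<in> space (P k)" if "\<omega> \<in> space M" for k \<omega>
    using measurable_space[OF S_meas that] .
  have z_step: "z (Suc k) \<omega> = sdcd_update \<gamma> \<zeta> A b (S k \<omega>) (X (z k \<omega>)) (z k \<omega>)"
    if "\<omega> \<in> space M" for k \<omega>
    using z_Suc[OF that] x_def[OF that] by (simp add: X_def)
  \<comment> \<open>The error bound with \<nu> is available only for subgradients in this subspace,
    which every update preserves.\<close>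
  have z_range: "z k \<omega> \<in> range ((*v) (transpose A))" if "\<omega> \<in> space M" for k \<omega>
  proof (induction k)
    case 0
    then show ?case using z0 z_0[OF that] by simp
  next
    case (Suc k)
    have sub: "subspace (range ((*v) (transpose A)))"
      by (intro linear_subspace_image matrix_vector_mul_linear subspace_UNIV)
    show ?case
      unfolding z_step[OF that] sdcd_update_eq
      by (intro subspace_diff[OF sub Suc] subspace_scale[OF sub] rangeI)
  qed
  have D_step: "D (z (Suc k) \<omega>) \<le> D (z k \<omega>)
      - \<kappa> * (sampling_weight (P k) (S k \<omega>) * (r (z k \<omega>) \<bullet> (gram (S k \<omega>) *v r (z k \<omega>))) / \<Lambda> k)"
    if "\<omega> \<in> space M" for k \<omega>
    unfolding z_step[OF that] by (rule descent[OF S_space[OF that]])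
  have D_bound: "D (z k \<omega>) \<le> D z0" if "\<omega> \<in> space M" for k \<omega>
  proof (induction k)
    case 0
    then show ?case using z_0[OF that] by simp
  next
    case (Suc k)
    then show ?case
      using D_step[OF that, of k] gain_nonneg[of k "S k \<omega>" "z k \<omega>"] by linarith
  qed

  \<comment> \<open>Measurability and integrability of the iterates\<close>
  have [measurable]: "X \<in> borel_measurable borel"
    unfolding X_def
    by (intro borel_measurable_continuous_onI continuous_on_gradient_conjugate[OF sc \<gamma>])
  have [measurable]: "conjugate f \<in> borel_measurable borel"
    by (intro borel_measurable_continuous_onI continuous_on_conjugate[OF sc \<gamma>])
  have [measurable]: "r \<in> borel_measurable borel" unfolding r_def by measurable
  have D_meas [measurable]: "D \<in> borel_measurable borel"
    unfolding D_def X_def bregman_conjugate[OF sc \<gamma>] by measurable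
  have gram_meas: "gram \<in> borel_measurable (P k)" for k using gram_integrable by simp
  \<comment> \<open>\<open>z k\<close> depends on the samples before \<open>k\<close> only. A
    general horizon \<open>n\<close> lets the induction treat \<open>z k\<close> and
    \<open>S k\<close> in the same sigma-algebra.\<close>
  have z_hist: "k \<le> n \<Longrightarrow> z k \<in> borel_measurable (history M P S n)" for k n
  proof (induction k)
    case 0
    have "z 0 \<in> borel_measurable (history M P S n) \<longleftrightarrow> (\<lambda>_. z0) \<in> borel_measurable (history M P S n)"
      by (rule measurable_cong) (simp add: history_def z_0)
    then show ?case by simp
  next
    case (Suc k)
    then have [measurable]: "z k \<in> borel_measurable (history M P S n)" by simp
    have [measurable]: "(\<lambda>\<omega>. gram (S k \<omega>)) \<in> borel_measurable (history M P S n)"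
      unfolding history_def using Suc.prems
      by (intro measurable_compose[OF measurable_sample_vimage_algebra[OF S_indep] gram_meas]) simp
    have "z (Suc k) \<in> borel_measurable (history M P S n) \<longleftrightarrow>
        (\<lambda>\<omega>. sdcd_update \<gamma> \<zeta> A b (S k \<omega>) (X (z k \<omega>)) (z k \<omega>)) \<in> borel_measurable (history M P S n)"
      by (rule measurable_cong) (simp add: history_def z_step)
    also have \<dots>
      unfolding sdcd_update_eq by measurable
    finally show ?case .
  qed
  have z_meas [measurable]: "z k \<in> borel_measurable M" for k
    by (rule measurable_from_subalg[OF subalgebra_history[OF S_indep] z_hist[OF order_refl]])
  have D_int: "integrable M (\<lambda>\<omega>. D (z k \<omega>))" for k
    using D_bound D_nonneg by (intro integrable_const_bound[of _ "D z0"] AE_I2) auto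

  \<comment> \<open>Conditional contraction in one step\<close>
  have cond: "AE \<omega> in M. real_cond_exp M (history M P S k) (\<lambda>\<omega>. D (z (Suc k) \<omega>)) \<omega> \<le> c k * D (z k \<omega>)"
    for k
  proof -
    let ?F = "history M P S k" and ?F' = "vimage_algebra (space M) (S k) (P k)"
    let ?H = "sampling_H (P k)"
    define W where "W T = sampling_weight (P k) T *\<^sub>R gram T" for T
    have F: "subalgebra M ?F" by (rule subalgebra_history[OF S_indep])
    interpret finite_measure_subalgebra M ?F by unfold_locales (rule F)
    have W: "integrable (P k) W"
      unfolding W_def by (rule integrable_weighted_gram[OF P_prob gram_integrable])
    then have W_int: "integrable M (\<lambda>\<omega>. W (S k \<omega>))"
      using integrable_distr_eq[OF S_meas, of W k] S_distr[of k] by simp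
    have W_mean: "(\<integral>\<omega>. W (S k \<omega>) \<partial>M) = ?H"
      using integral_distr[OF S_meas, of W k] W S_distr[of k]
      unfolding sampling_H_eq W_def[symmetric] by simp
    obtain K where K: "K > 0" "\<And>v. norm (A *v v) \<le> norm v * K"
      using bounded_linear.pos_bounded[OF matrix_vector_mul_bounded_linear[of A]] by blast
    \<comment> \<open>Pathwise descent bounds the residual uniformly, which the conditional
      expectation of the quadratic form asks for.\<close>
    have r_bound: "norm (r (z k \<omega>)) \<le> sqrt (2 / \<gamma> * D z0) * K" if "\<omega> \<in> space M" for \<omega>
    proof -
      have "(norm (X (z k \<omega>) - xhat))\<^sup>2 \<le> 2 / \<gamma> * D z0"
        using dist_le[of "z k \<omega>"] mult_left_mono[OF D_bound[OF that, of k], of "2 / \<gamma>"] \<gamma> by simp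
      then have "norm (X (z k \<omega>) - xhat) \<le> sqrt (2 / \<gamma> * D z0)" by (rule real_le_rsqrt)
      then show ?thesis
        unfolding r_eq using K(2)[of "X (z k \<omega>) - xhat"] K(1) by (meson mult_right_mono less_imp_le order_trans)
    qed
    have rF: "(\<lambda>\<omega>. r (z k \<omega>)) \<in> borel_measurable ?F"
      using z_hist[of k k] by measurable
    have WF': "(\<lambda>\<omega>. W (S k \<omega>)) \<in> borel_measurable ?F'"
      using measurable_space[OF S_meas] W
      by (intro measurable_compose[OF measurable_vimage_algebra1]) auto
    let ?Q = "\<lambda>\<omega>. r (z k \<omega>) \<bullet> (W (S k \<omega>) *v r (z k \<omega>))"
    note Q = real_cond_exp_quadratic_form[OF indep_set_history[OF S_indep] F
        subalgebra_vimage_algebra[OF S_meas] rF r_bound WF' W_int, unfolded W_mean]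
    have "AE \<omega> in M. real_cond_exp M ?F (\<lambda>\<omega>. D (z (Suc k) \<omega>)) \<omega>
        \<le> real_cond_exp M ?F (\<lambda>\<omega>. D (z k \<omega>) - \<kappa> / \<Lambda> k * ?Q \<omega>) \<omega>"
    proof (rule real_cond_exp_mono)
      show "AE \<omega> in M. D (z (Suc k) \<omega>) \<le> D (z k \<omega>) - \<kappa> / \<Lambda> k * ?Q \<omega>"
        using D_step[of _ k]
        by (intro AE_I2) (simp add: W_def scaleR_matrix_vector_assoc[symmetric])
      show "integrable M (\<lambda>\<omega>. D (z k \<omega>) - \<kappa> / \<Lambda> k * ?Q \<omega>)"
        by (intro Bochner_Integration.integrable_diff D_int integrable_mult_right Q(1))
    qed (rule D_int)
    moreover have "AE \<omega> in M. real_cond_exp M ?F (\<lambda>\<omega>. D (z k \<omega>) - \<kappa> / \<Lambda> k * ?Q \<omega>) \<omega>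
        = real_cond_exp M ?F (\<lambda>\<omega>. D (z k \<omega>)) \<omega> - real_cond_exp M ?F (\<lambda>\<omega>. \<kappa> / \<Lambda> k * ?Q \<omega>) \<omega>"
      by (intro real_cond_exp_diff D_int integrable_mult_right Q(1))
    moreover have "AE \<omega> in M. real_cond_exp M ?F (\<lambda>\<omega>. D (z k \<omega>)) \<omega> = D (z k \<omega>)"
      by (intro real_cond_exp_F_meas D_int measurable_compose[OF z_hist[OF order_refl] D_meas])
    moreover have "AE \<omega> in M. real_cond_exp M ?F (\<lambda>\<omega>. \<kappa> / \<Lambda> k * ?Q \<omega>) \<omega>
        = \<kappa> / \<Lambda> k * real_cond_exp M ?F ?Q \<omega>"
      by (rule real_cond_exp_cmult[OF Q(1)])
    moreover have "AE \<omega> in M. real_cond_exp M ?F ?Q \<omega> = r (z k \<omega>) \<bullet> (?H *v r (z k \<omega>))"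
      by (rule Q(2))
    moreover note AE_space
    ultimately show ?thesis
    proof eventually_elim
      case (elim \<omega>)
      then show ?case using contraction[OF z_range, of \<omega> k k] by simp
    qed
  qed

  \<comment> \<open>If a factor were negative, one step of the algorithm started at \<open>z0\<close> with that sampling
    law would give a negative expected Bregman distance.\<close>
  have c_nonneg: "c k \<ge> 0" if "D z0 > 0" for k
  proof -
    interpret Pk: prob_space "P k" by (rule P_prob)
    let ?g = "\<lambda>T. sampling_weight (P k) T * (r z0 \<bullet> (gram T *v r z0))"
    note H = sampling_H_form[OF P_prob gram_integrable, where u = "r z0" and v = "r z0", of k]
    have "\<kappa> * (?g T / \<Lambda> k) \<le> D z0" if "T \<in> space (P k)" for T
      using descent[OF that, of z0] D_nonneg[of "sdcd_update \<gamma> \<zeta> A b T (X z0) z0"] by linarith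
    then have "(\<integral>T. \<kappa> * (?g T / \<Lambda> k) \<partial>P k) \<le> (\<integral>T. D z0 \<partial>P k)"
      by (intro integral_mono_AE AE_I2 integrable_mult_right integrable_divide H(2)) auto
    then have "\<kappa> * (r z0 \<bullet> (sampling_H (P k) *v r z0) / \<Lambda> k) \<le> D z0"
      unfolding H(1) by (simp add: Pk.prob_space)
    then have "0 \<le> c k * D z0" using contraction[OF z0, of k] by linarith
    then show ?thesis using that by (simp add: zero_le_mult_iff)
  qed

  \<comment> \<open>Decay of the expected Bregman distance\<close>
  have mean: "(\<integral>\<omega>. D (z k \<omega>) \<partial>M) \<le> D z0 * (\<Prod>i<k. c i)" for k
  \<comment> \<open>The induction multiplies by \<open>c k\<close>, whose sign is known only for
    \<open>D z0 > 0\<close>. Otherwise descent keeps the distance at 0 on every path.\<close>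
  proof (cases "D z0 > 0")
    case False
    then have "D z0 = 0" using D_nonneg[of z0] by linarith
    then have "(\<integral>\<omega>. D (z k \<omega>) \<partial>M) \<le> (\<integral>\<omega>. 0 \<partial>M)"
      using D_bound by (intro integral_mono_AE AE_I2 D_int) auto
    then show ?thesis using \<open>D z0 = 0\<close> by simp
  next
    case True
    show ?thesis
    proof (induction k)
      case 0
      have "(\<integral>\<omega>. D (z 0 \<omega>) \<partial>M) = (\<integral>\<omega>. D z0 \<partial>M)"
        by (intro Bochner_Integration.integral_cong) (simp_all add: z_0)
      then show ?case by (simp add: prob_space)
    next
      case (Suc k)
      interpret finite_measure_subalgebra M "history M P S k"
        by unfold_locales (rule subalgebra_history[OF S_indep])
      have "(\<integral>\<omega>. D (z (Suc k) \<omega>) \<partial>M)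
          = (\<integral>\<omega>. real_cond_exp M (history M P S k) (\<lambda>\<omega>. D (z (Suc k) \<omega>)) \<omega> \<partial>M)"
        by (rule real_cond_exp_int(2)[OF D_int, symmetric])
      also have "\<dots> \<le> (\<integral>\<omega>. c k * D (z k \<omega>) \<partial>M)"
        by (intro integral_mono_AE real_cond_exp_int(1) D_int integrable_mult_right cond)
      also have "\<dots> = c k * (\<integral>\<omega>. D (z k \<omega>) \<partial>M)" by simp
      also have "\<dots> \<le> c k * (D z0 * (\<Prod>i<k. c i))"
        by (intro mult_left_mono Suc c_nonneg True)
      finally show ?case by (simp add: mult_ac)
    qed
  qed

  \<comment> \<open>Transfer to the primal iterates\<close>
  have x_eq: "bregman f (z k \<omega>) (x k \<omega>) xhat = D (z k \<omega>)" "x k \<omega> = X (z k \<omega>)"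
    if "\<omega> \<in> space M" for k \<omega>
    using x_def[OF that] by (simp_all add: D_def X_def)
  show ?thesis
  proof (intro conjI allI)
    fix k
    interpret finite_measure_subalgebra M "history M P S k"
      by unfold_locales (rule subalgebra_history[OF S_indep])
    let ?B = "\<lambda>\<omega>. bregman f (z (Suc k) \<omega>) (x (Suc k) \<omega>) xhat"
    \<comment> \<open>The iterates are prescribed on \<open>space M\<close> only, so the claims are
      carried over by congruence rules rather than by rewriting.\<close>
    show B: "integrable M ?B"
      by (rule Bochner_Integration.integrable_cong[OF refl, THEN iffD2, OF _ D_int]) (rule x_eq(1))
    have "AE \<omega> in M. real_cond_exp M (history M P S k) ?B \<omega>
        = real_cond_exp M (history M P S k) (\<lambda>\<omega>. D (z (Suc k) \<omega>)) \<omega>"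
      using B by (intro real_cond_exp_cong AE_I2 x_eq(1)) auto
    with cond[of k] AE_space
    show "AE \<omega> in M. real_cond_exp M (history M P S k) ?B \<omega>
        \<le> contraction_factor \<gamma> \<zeta> \<nu> A (P k) * bregman f (z k \<omega>) (x k \<omega>) xhat"
      by eventually_elim (simp add: x_eq(1) c_def)
  next
    fix k
    let ?N = "\<lambda>\<omega>. (norm (X (z k \<omega>) - xhat))\<^sup>2"
    have N_int: "integrable M ?N"
    proof (rule Bochner_Integration.integrable_bound)
      show "integrable M (\<lambda>\<omega>. 2 / \<gamma> * D (z k \<omega>))" by (intro integrable_mult_right D_int)
      show "AE \<omega> in M. norm (?N \<omega>) \<le> norm (2 / \<gamma> * D (z k \<omega>))"
        using dist_le D_nonneg \<gamma> by (intro AE_I2) simp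
    qed measurable
    show "integrable M (\<lambda>\<omega>. (norm (x k \<omega> - xhat))\<^sup>2)"
      by (rule Bochner_Integration.integrable_cong[OF refl, THEN iffD2, OF _ N_int]) (simp add: x_eq(2))
    have "(\<integral>\<omega>. (norm (x k \<omega> - xhat))\<^sup>2 \<partial>M) = (\<integral>\<omega>. ?N \<omega> \<partial>M)"
      by (rule Bochner_Integration.integral_cong) (simp_all add: x_eq(2))
    also have "\<dots> \<le> (\<integral>\<omega>. 2 / \<gamma> * D (z k \<omega>) \<partial>M)"
      by (intro integral_mono_AE AE_I2 N_int integrable_mult_right D_int dist_le)
    also have "\<dots> = 2 / \<gamma> * (\<integral>\<omega>. D (z k \<omega>) \<partial>M)" by simp
    also have "\<dots> \<le> 2 / \<gamma> * (D z0 * (\<Prod>i<k. c i))"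
      using \<gamma> by (intro mult_left_mono mean) simp
    finally show "(\<integral>\<omega>. (norm (x k \<omega> - xhat))\<^sup>2 \<partial>M)
        \<le> 2 * bregman f z0 (gradient (conjugate f) z0) xhat / \<gamma> *
          (\<Prod>i<k. contraction_factor \<gamma> \<zeta> \<nu> A (P i))"
      by (simp add: D_def X_def c_def)
  qed
qed

end
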